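(* Let $h$ be either $\mathsf{MAJ}_3\colon\{0,1\}^3\to\{0,1\}$ or $\mathsf{AND}_2\circ\mathsf{OR}_2\colon\{0,1\}^4\to\{0,1\}$. There is a large enough constant $C>0$ such that for all Boolean functions $f$ and $g$, with $n$ the arity of the outer function in each composition below and $d\geq C\log\log n$, \[\widetilde{\deg}(f\circ h^d)=\Omega\left(\frac{\widetilde{\deg}(f)\,\widetilde{\deg}(h^d)}{\mathrm{polylog}(n)}\right)\quad\text{and}\quad \widetilde{\deg}(h^d\circ g)=\Omega\left(\frac{\widetilde{\deg}(h^d)\,\widetilde{\deg}(g)}{\mathrm{polylog}(n)}\right).\]
   Context: For Boolean $f\colon\{0,1\}^n\to\{0,1\}$, $g\colon\{0,1\}^m\to\{0,1\}$, the composition is $f\circ g(x_1,\dots,x_n)=f(g(x_1),\dots,g(x_n))$, $x_i\in\{0,1\}^m$. $h^d$ denotes $h$ composed with itself $d$ times. $\mathsf{MAJ}_3$ is the majority function on 3 bits; $\mathsf{AND}_2\circ\mathsf{OR}_2(x_1,x_2,x_3,x_4)=(x_1\vee x_2)\wedge(x_3\vee x_4)$. $\widetilde{\deg}(f)$ is the minimum degree of a real polynomial $p$ with $|p(x)-f(x)|\leq 1/3$ for all Boolean inputs $x$. $\mathrm{polylog}(n)$ denotes a factor $(\log n)^{O(1)}$. *)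

theory Defs
  imports Complex_Main "HOL-Library.Poly_Mapping"
begin

text \<open>
  A Boolean function on n bits is a function \<open>bool list \<Rightarrow> bool\<close> together with its arity n; only its
  values on lists of length n matter.
\<close>

type_synonym boolfun = "bool list \<Rightarrow> bool"

text \<open>
  Composition: the input of length \<open>n * m\<close> is cut into n consecutive blocks of length m.
\<close>

definition bcomp :: "nat \<Rightarrow> nat \<Rightarrow> boolfun \<Rightarrow> boolfun \<Rightarrow> boolfun" where
  "bcomp n m f g = (\<lambda>x. f (map (\<lambda>i. g (take m (drop (i * m) x))) [0..<n]))"

text \<open>
  The d-fold composition of h (of arity k) with itself, of arity \<open>k ^ d\<close>; the 0-fold composition is
  the identity on one bit.
\<close>

fun biter :: "nat \<Rightarrow> boolfun \<Rightarrow> nat \<Rightarrow> boolfun" where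
  "biter k h 0 = hd"
| "biter k h (Suc d) = bcomp k (k ^ d) h (biter k h d)"

definition maj3 :: boolfun where
  "maj3 x \<longleftrightarrow> 2 \<le> count_list x True"

definition and2 :: boolfun where
  "and2 x \<longleftrightarrow> x ! 0 \<and> x ! 1"

definition or2 :: boolfun where
  "or2 x \<longleftrightarrow> x ! 0 \<or> x ! 1"

definition and2_or2 :: boolfun where
  "and2_or2 = bcomp 2 2 and2 or2"

text \<open>
  Real multivariate polynomials: finitely supported maps from monomials (finitely supported exponent
  vectors) to coefficients. The degree is the total degree, with degree 0 for the zero polynomial.
\<close>

type_synonym rpoly = "(nat \<Rightarrow>\<^sub>0 nat) \<Rightarrow>\<^sub>0 real"

definition rpoly_vars :: "rpoly \<Rightarrow> nat set" where
  "rpoly_vars p = (\<Union>m\<in>Poly_Mapping.keys p. Poly_Mapping.keys m)"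

definition rpoly_degree :: "rpoly \<Rightarrow> nat" where
  "rpoly_degree p =
     Max (insert 0 ((\<lambda>m. \<Sum>i\<in>Poly_Mapping.keys m. Poly_Mapping.lookup m i) ` Poly_Mapping.keys p))"

definition rpoly_eval :: "rpoly \<Rightarrow> (nat \<Rightarrow> real) \<Rightarrow> real" where
  "rpoly_eval p x =
     (\<Sum>m\<in>Poly_Mapping.keys p. Poly_Mapping.lookup p m *
        (\<Prod>i\<in>Poly_Mapping.keys m. x i ^ Poly_Mapping.lookup m i))"

definition approximates :: "nat \<Rightarrow> rpoly \<Rightarrow> boolfun \<Rightarrow> bool" where
  "approximates n p f \<longleftrightarrow> rpoly_vars p \<subseteq> {..<n} \<and>
     (\<forall>x. length x = n \<longrightarrow> \<bar>rpoly_eval p (\<lambda>i. of_bool (x ! i)) - of_bool (f x)\<bar> \<le> 1 / 3)"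

definition adeg :: "nat \<Rightarrow> boolfun \<Rightarrow> nat" where
  "adeg n f = (LEAST D. \<exists>p. approximates n p f \<and> rpoly_degree p = D)"

end

theory Submission
  imports Defs
begin

text \<open>
  If no polynomial of degree below \<open>D\<close> approximates \<open>g\<close>, linear programming duality yields distributions
  \<open>\<mu>\<^sub>0\<close>, \<open>\<mu>\<^sub>1\<close> that agree on all monomials of degree below \<open>D\<close>, while \<open>g\<close> takes the value \<open>b\<close> with probability
  at least \<open>2/3\<close> under \<open>\<mu>\<^sub>b\<close>. Powers of \<open>\<mu>\<^sub>0\<close> and \<open>\<mu>\<^sub>1\<close> still agree below degree \<open>D\<close>, and each level of \<open>h\<close>
  maps the error probability \<open>\<epsilon>\<close> to at most \<open>(\<epsilon> (2 - \<epsilon>))\<^sup>2\<close>, so after \<open>a = log log n + O(1)\<close> levels the error of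
  \<open>h\<^sup>a \<circ> g\<close> is a small constant times \<open>1/n\<close>. Averaging a polynomial \<open>p\<close> for \<open>f \<circ> h\<^sup>a \<circ> g\<close> over these powers, chosen
  block by block according to \<open>z\<close>, gives an approximation of \<open>f z\<close>. A block contributes to the degree in \<open>z\<close>
  only if it carries degree at least \<open>D\<close>, so the result has degree at most \<open>deg p div D\<close>. The \<open>a\<close> levels
  spent are recovered up to a factor \<open>k\<^sup>a = polylog n\<close>, because \<open>h\<^sup>d = h\<^bsup>d-a\<^esup> \<circ> h\<^sup>a\<close> and \<open>h\<^sup>a\<close> is a polynomial
  of degree at most \<open>k\<^sup>a\<close>.
\<close>

section \<open>Functions of low degree on the cube\<close>

definition bits :: "nat \<Rightarrow> bool list set" where
  "bits n = {x. length x = n}"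

text \<open>The multilinear monomial with support \<open>S\<close>, seen on the cube: powers of a
  bit collapse, and a product of bits is a conjunction.\<close>

definition chi :: "nat set \<Rightarrow> bool list \<Rightarrow> real" where
  "chi S x = of_bool (\<forall>i\<in>S. x ! i)"

text \<open>Degree is attached to a function on the cube, with agreement required only on
  \<open>bits n\<close>; this frees the argument from the choice of a representing
  polynomial.\<close>

definition low_degree :: "nat \<Rightarrow> nat \<Rightarrow> (bool list \<Rightarrow> real) \<Rightarrow> bool" where
  "low_degree n D F \<longleftrightarrow>
     (\<exists>c. \<forall>x\<in>bits n. F x = (\<Sum>S | S \<subseteq> {..<n} \<and> card S \<le> D. c S * chi S x))"

lemma finite_bits [simp]: "finite (bits n)"
  using finite_lists_length_eq[of "UNIV :: bool set" n] by (simp add: bits_def)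

lemma finite_low_sets [simp]: "finite {S. S \<subseteq> {..<n::nat} \<and> P S}"
  by (rule finite_subset[of _ "Pow {..<n}"]) auto

lemma chi_empty [simp]: "chi {} x = 1"
  by (simp add: chi_def)

lemma chi_mult: "chi S x * chi T x = chi (S \<union> T) x"
  by (auto simp: chi_def)

lemma low_degree_cong:
  assumes "low_degree n D F" "\<And>x. x \<in> bits n \<Longrightarrow> F x = G x"
  shows "low_degree n D G"
  using assms unfolding low_degree_def by auto

lemma low_degree_add:
  assumes "low_degree n D F" "low_degree n D G"
  shows "low_degree n D (\<lambda>x. F x + G x)"
proof -
  obtain c c' where "\<forall>x\<in>bits n. F x = (\<Sum>S | S \<subseteq> {..<n} \<and> card S \<le> D. c S * chi S x)"
    "\<forall>x\<in>bits n. G x = (\<Sum>S | S \<subseteq> {..<n} \<and> card S \<le> D. c' S * chi S x)"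
    using assms unfolding low_degree_def by blast
  then show ?thesis unfolding low_degree_def
    by (intro exI[of _ "\<lambda>S. c S + c' S"]) (simp add: distrib_right sum.distrib)
qed

lemma low_degree_scale:
  assumes "low_degree n D F"
  shows "low_degree n D (\<lambda>x. r * F x)"
proof -
  obtain c where "\<forall>x\<in>bits n. F x = (\<Sum>S | S \<subseteq> {..<n} \<and> card S \<le> D. c S * chi S x)"
    using assms unfolding low_degree_def by blast
  then show ?thesis unfolding low_degree_def
    by (intro exI[of _ "\<lambda>S. r * c S"]) (simp add: sum_distrib_left mult.assoc)
qed

lemma low_degree_chi:
  assumes "S \<subseteq> {..<n}" "card S \<le> D"
  shows "low_degree n D (chi S)"
proof -
  have "(\<Sum>T | T \<subseteq> {..<n} \<and> card T \<le> D. of_bool (T = S) * chi T x) = chi S x" for x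
  proof -
    have "(\<Sum>T | T \<subseteq> {..<n} \<and> card T \<le> D. of_bool (T = S) * chi T x)
        = (\<Sum>T | T \<subseteq> {..<n} \<and> card T \<le> D. if T = S then chi T x else 0)"
      by (intro sum.cong) auto
    also have "\<dots> = chi S x"
      using assms by (subst sum.delta) auto
    finally show ?thesis .
  qed
  then show ?thesis unfolding low_degree_def
    by (intro exI[of _ "\<lambda>T. of_bool (T = S)"]) simp
qed

lemma low_degree_const [simp]: "low_degree n D (\<lambda>x. r)"
  using low_degree_scale[OF low_degree_chi[of "{}" n D], of r] by simp

lemma low_degree_sum:
  assumes "\<And>i. i \<in> A \<Longrightarrow> low_degree n D (F i)"
  shows "low_degree n D (\<lambda>x. \<Sum>i\<in>A. F i x)"
proof (cases "finite A")
  case True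
  then show ?thesis using assms
    by (induction A rule: finite_induct) (auto intro: low_degree_add)
qed simp

lemma low_degree_weaken:
  assumes "low_degree n D F" "D \<le> D'"
  shows "low_degree n D' F"
proof -
  obtain c where c: "\<forall>x\<in>bits n. F x = (\<Sum>S | S \<subseteq> {..<n} \<and> card S \<le> D. c S * chi S x)"
    using assms unfolding low_degree_def by blast
  have "low_degree n D' (\<lambda>x. \<Sum>S | S \<subseteq> {..<n} \<and> card S \<le> D. c S * chi S x)"
    using assms(2) by (intro low_degree_sum low_degree_scale low_degree_chi) auto
  then show ?thesis by (rule low_degree_cong) (simp add: c)
qed

text \<open>Supports unite under multiplication, and the size of a union is at most the sum of the
  sizes.\<close>

lemma low_degree_mult:
  assumes "low_degree n D F" "low_degree n D' G"
  shows "low_degree n (D + D') (\<lambda>x. F x * G x)"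
proof -
  obtain c c' where c: "\<forall>x\<in>bits n. F x = (\<Sum>S | S \<subseteq> {..<n} \<and> card S \<le> D. c S * chi S x)"
    "\<forall>x\<in>bits n. G x = (\<Sum>S | S \<subseteq> {..<n} \<and> card S \<le> D'. c' S * chi S x)"
    using assms unfolding low_degree_def by blast
  have "low_degree n (D + D') (\<lambda>x. \<Sum>S | S \<subseteq> {..<n} \<and> card S \<le> D.
      \<Sum>T | T \<subseteq> {..<n} \<and> card T \<le> D'. (c S * c' T) * chi (S \<union> T) x)"
    by (intro low_degree_sum low_degree_scale low_degree_chi)
       (auto intro: order_trans[OF card_Un_le])
  then show ?thesis
  proof (rule low_degree_cong)
    fix x assume "x \<in> bits n"
    then show "(\<Sum>S | S \<subseteq> {..<n} \<and> card S \<le> D. \<Sum>T | T \<subseteq> {..<n} \<and> card T \<le> D'.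
        (c S * c' T) * chi (S \<union> T) x) = F x * G x"
      unfolding c(1)[rule_format, OF \<open>x \<in> bits n\<close>] c(2)[rule_format, OF \<open>x \<in> bits n\<close>] sum_product
      by (intro sum.cong refl) (simp add: chi_mult[symmetric])
  qed
qed

lemma low_degree_prod:
  assumes "finite A" "\<And>i. i \<in> A \<Longrightarrow> low_degree n (d i) (F i)"
  shows "low_degree n (\<Sum>i\<in>A. d i) (\<lambda>x. \<Prod>i\<in>A. F i x)"
  using assms by (induction A rule: finite_induct) (auto intro: low_degree_mult)

lemma low_degree_var:
  assumes "i < n"
  shows "low_degree n 1 (\<lambda>x. of_bool (x ! i))"
  using low_degree_chi[of "{i}" n 1] assms by (simp add: chi_def[abs_def])

text \<open>Lagrange interpolation: the indicator of a point \<open>y\<close> is a product of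
  \<open>n\<close> affine factors, each either a bit or its complement.\<close>

lemma low_degree_exact: "low_degree n n F"
proof -
  have low: "low_degree n 1 (\<lambda>x. if x ! i = b then 1 else 0)" if "i < n" for i b
  proof (cases b)
    case True
    then show ?thesis
      by (intro low_degree_cong[OF low_degree_var[OF that]]) auto
  next
    case False
    then show ?thesis
      by (intro low_degree_cong[OF low_degree_add[OF low_degree_const[of n 1 1]
            low_degree_scale[OF low_degree_var[OF that], of "-1"]]]) auto
  qed
  have "low_degree n (\<Sum>i<n. 1)
      (\<lambda>x. \<Sum>y\<in>bits n. F y * (\<Prod>i<n. if x ! i = y ! i then 1 else 0))"
    using low by (intro low_degree_sum low_degree_scale low_degree_prod) auto
  then have "low_degree n n (\<lambda>x. \<Sum>y\<in>bits n. F y * (\<Prod>i<n. if x ! i = y ! i then 1 else 0))"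
    by simp
  then show ?thesis
  proof (rule low_degree_cong)
    fix x assume x: "x \<in> bits n"
    have "(\<Prod>i<n. if x ! i = y ! i then 1 else 0) = (if y = x then 1 else (0::real))"
      if "y \<in> bits n" for y
      using that x by (auto simp: bits_def list_eq_iff_nth_eq)
    then have "(\<Sum>y\<in>bits n. F y * (\<Prod>i<n. if x ! i = y ! i then 1 else 0))
        = (\<Sum>y\<in>bits n. if y = x then F y else 0)"
      by (intro sum.cong) auto
    then show "(\<Sum>y\<in>bits n. F y * (\<Prod>i<n. if x ! i = y ! i then 1 else 0)) = F x"
      using x by simp
  qed
qed

text \<open>A monomial of \<open>F\<close> turns into a product of at most \<open>D\<close>
  functions of degree at most \<open>K\<close>.\<close>

lemma low_degree_compose:
  assumes F: "low_degree n D F"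
    and G: "\<And>i. i < n \<Longrightarrow> low_degree N K (\<lambda>x. of_bool (G i x))"
  shows "low_degree N (D * K) (\<lambda>x. F (map (\<lambda>i. G i x) [0..<n]))"
proof -
  obtain c where c: "\<forall>x\<in>bits n. F x = (\<Sum>S | S \<subseteq> {..<n} \<and> card S \<le> D. c S * chi S x)"
    using F unfolding low_degree_def by blast
  have "low_degree N (D * K) (\<lambda>x. \<Prod>i\<in>S. of_bool (G i x))"
    if S: "S \<subseteq> {..<n}" "card S \<le> D" for S
  proof -
    have "low_degree N (\<Sum>i\<in>S. K) (\<lambda>x. \<Prod>i\<in>S. of_bool (G i x))"
      using S G by (intro low_degree_prod) (auto intro: finite_subset)
    then show ?thesis
      by (rule low_degree_weaken) (use S in auto)
  qed
  then have "low_degree N (D * K)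
      (\<lambda>x. \<Sum>S | S \<subseteq> {..<n} \<and> card S \<le> D. c S * (\<Prod>i\<in>S. of_bool (G i x)))"
    by (intro low_degree_sum low_degree_scale) auto
  then show ?thesis
  proof (rule low_degree_cong)
    fix x
    have "(\<Prod>i\<in>S. of_bool (G i x)) = chi S (map (\<lambda>i. G i x) [0..<n])"
      if S: "S \<subseteq> {..<n}" for S
    proof -
      have fin: "finite S" using S finite_subset by blast
      have "(\<Prod>i\<in>S. of_bool (G i x)) = (of_bool (\<forall>i\<in>S. G i x) :: real)"
        using fin by (induction S rule: finite_induct) auto
      then show ?thesis using S by (force simp: chi_def)
    qed
    then show "(\<Sum>S | S \<subseteq> {..<n} \<and> card S \<le> D. c S * (\<Prod>i\<in>S. of_bool (G i x)))
        = F (map (\<lambda>i. G i x) [0..<n])"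
      by (simp add: c bits_def)
  qed
qed

section \<open>Approximate degree\<close>

text \<open>The error is a parameter because averaging over random inputs later yields an error
  slightly above \<open>1 / 3\<close>, which must then be reduced.\<close>

definition approx :: "nat \<Rightarrow> nat \<Rightarrow> real \<Rightarrow> boolfun \<Rightarrow> bool" where
  "approx n D \<epsilon> f \<longleftrightarrow> (\<exists>F. low_degree n D F \<and> (\<forall>x\<in>bits n. \<bar>F x - of_bool (f x)\<bar> \<le> \<epsilon>))"

section \<open>Translation between polynomials and functions of low degree\<close>

lemma rpoly_degree_le_iff:
  "rpoly_degree p \<le> D \<longleftrightarrow>
     (\<forall>m\<in>Poly_Mapping.keys p. (\<Sum>i\<in>Poly_Mapping.keys m. Poly_Mapping.lookup m i) \<le> D)"
  unfolding rpoly_degree_def by (subst Max_le_iff) auto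

lemma rpoly_eval_superset:
  assumes "finite M" "Poly_Mapping.keys p \<subseteq> M"
  shows "rpoly_eval p x = (\<Sum>m\<in>M. Poly_Mapping.lookup p m *
    (\<Prod>i\<in>Poly_Mapping.keys m. x i ^ Poly_Mapping.lookup m i))"
  unfolding rpoly_eval_def using assms
  by (intro sum.mono_neutral_left) (auto simp: in_keys_iff)

lemma rpoly_eval_add: "rpoly_eval (p + q) x = rpoly_eval p x + rpoly_eval q x"
proof -
  let ?M = "Poly_Mapping.keys p \<union> Poly_Mapping.keys q"
  have "Poly_Mapping.keys (p + q) \<subseteq> ?M" by (rule Poly_Mapping.keys_add)
  then show ?thesis
    by (simp add: rpoly_eval_superset[of ?M] lookup_add distrib_right sum.distrib)
qed

lemma rpoly_eval_single:
  "rpoly_eval (Poly_Mapping.single m c) x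
     = c * (\<Prod>i\<in>Poly_Mapping.keys m. x i ^ Poly_Mapping.lookup m i)"
  by (subst rpoly_eval_superset[of "{m}"]) auto

lemma monomial_on_bits:
  "(\<Prod>i\<in>Poly_Mapping.keys m. of_bool (x ! i) ^ Poly_Mapping.lookup m i)
     = chi (Poly_Mapping.keys m) x"
proof -
  have "(\<Prod>i\<in>Poly_Mapping.keys m. of_bool (x ! i) ^ Poly_Mapping.lookup m i)
      = (\<Prod>i\<in>Poly_Mapping.keys m. of_bool (x ! i) :: real)"
    by (intro prod.cong) (auto simp: in_keys_iff)
  also have "(\<Prod>i\<in>S. of_bool (x ! i) :: real) = chi S x" if "finite S" for S
    using that by (induction S rule: finite_induct) (auto simp: chi_def)
  finally show ?thesis by simp
qed

text \<open>On the cube a monomial depends only on its support, whose size is at most the total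
  degree since exponents on the support are at least 1.\<close>

lemma low_degree_rpoly:
  assumes "rpoly_vars p \<subseteq> {..<n}"
  shows "low_degree n (rpoly_degree p) (\<lambda>x. rpoly_eval p (\<lambda>i. of_bool (x ! i)))"
  unfolding rpoly_eval_def monomial_on_bits
proof (intro low_degree_sum low_degree_scale low_degree_chi)
  fix m assume m: "m \<in> Poly_Mapping.keys p"
  then show "Poly_Mapping.keys m \<subseteq> {..<n}"
    using assms by (auto simp: rpoly_vars_def)
  have "card (Poly_Mapping.keys m) = (\<Sum>i\<in>Poly_Mapping.keys m. 1)" by simp
  also have "\<dots> \<le> (\<Sum>i\<in>Poly_Mapping.keys m. Poly_Mapping.lookup m i)"
    by (intro sum_mono) (auto simp: in_keys_iff)
  also have "\<dots> \<le> rpoly_degree p"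
    using rpoly_degree_le_iff[of p "rpoly_degree p"] m by simp
  finally show "card (Poly_Mapping.keys m) \<le> rpoly_degree p" .
qed

text \<open>The multilinear polynomial is built one monomial at a time. Adding a term may cancel
  keys, so only inclusions of key sets are carried along.\<close>

lemma rpoly_of_low_degree:
  assumes "low_degree n D F"
  obtains p where "rpoly_vars p \<subseteq> {..<n}" "rpoly_degree p \<le> D"
    "\<And>x. x \<in> bits n \<Longrightarrow> rpoly_eval p (\<lambda>i. of_bool (x ! i)) = F x"
proof -
  obtain c where c: "\<forall>x\<in>bits n. F x = (\<Sum>S | S \<subseteq> {..<n} \<and> card S \<le> D. c S * chi S x)"
    using assms unfolding low_degree_def by blast
  have "\<exists>p. rpoly_vars p \<subseteq> {..<n} \<and> rpoly_degree p \<le> D \<and>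
      (\<forall>x. rpoly_eval p (\<lambda>i. of_bool (x ! i)) = (\<Sum>S\<in>A. c S * chi S x))"
    if "finite A" "A \<subseteq> {S. S \<subseteq> {..<n} \<and> card S \<le> D}" for A
    using that
  proof (induction A rule: finite_induct)
    case empty
    then show ?case
      by (intro exI[of _ 0]) (simp add: rpoly_vars_def rpoly_degree_def rpoly_eval_def)
  next
    case (insert S A)
    then obtain p where p: "rpoly_vars p \<subseteq> {..<n}" "rpoly_degree p \<le> D"
      "\<And>x. rpoly_eval p (\<lambda>i. of_bool (x ! i)) = (\<Sum>S\<in>A. c S * chi S x)"
      by auto
    have S: "S \<subseteq> {..<n}" "card S \<le> D" "finite S"
      using insert.prems finite_subset by auto
    define m where "m = (\<Sum>i\<in>S. Poly_Mapping.single i (1::nat))"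
    have lk: "Poly_Mapping.lookup m i = of_bool (i \<in> S)" for i
    proof -
      have "Poly_Mapping.lookup m i = (\<Sum>j\<in>S. if j = i then 1 else 0)"
        unfolding m_def lookup_sum by (intro sum.cong) (auto simp: lookup_single when_def)
      then show ?thesis using S(3) by simp
    qed
    have km: "Poly_Mapping.keys m = S"
      by (auto simp: in_keys_iff lk)
    let ?q = "p + Poly_Mapping.single m (c S)"
    have keys: "Poly_Mapping.keys ?q \<subseteq> insert m (Poly_Mapping.keys p)"
      using Poly_Mapping.keys_add[of p "Poly_Mapping.single m (c S)"] by (auto split: if_splits)
    have "rpoly_vars ?q \<subseteq> {..<n}"
      using keys p(1) S(1) km unfolding rpoly_vars_def by fastforce
    moreover have "rpoly_degree ?q \<le> D"
      using keys p(2) S(2) unfolding rpoly_degree_le_iff by (force simp: km lk)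
    moreover have "rpoly_eval ?q (\<lambda>i. of_bool (x ! i)) = (\<Sum>S\<in>insert S A. c S * chi S x)" for x
      using insert.hyps monomial_on_bits[of x m]
      by (simp add: rpoly_eval_add rpoly_eval_single p(3) km)
    ultimately show ?case by blast
  qed
  from this[OF finite_low_sets order_refl] show thesis
    using that c by auto
qed

lemma approx_exact: "approx n n (1 / 3) f"
  unfolding approx_def using low_degree_exact[of n "\<lambda>x. of_bool (f x)"] by force

lemma approx_iff_rpoly: "approx n D (1 / 3) f \<longleftrightarrow> (\<exists>p. approximates n p f \<and> rpoly_degree p \<le> D)"
proof
  assume "approx n D (1 / 3) f"
  then obtain F where F: "low_degree n D F" "\<forall>x\<in>bits n. \<bar>F x - of_bool (f x)\<bar> \<le> 1 / 3"
    unfolding approx_def by blast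
  obtain p where "rpoly_vars p \<subseteq> {..<n}" "rpoly_degree p \<le> D"
    "\<And>x. x \<in> bits n \<Longrightarrow> rpoly_eval p (\<lambda>i. of_bool (x ! i)) = F x"
    using rpoly_of_low_degree[OF F(1)] by blast
  then show "\<exists>p. approximates n p f \<and> rpoly_degree p \<le> D"
    using F(2) unfolding approximates_def bits_def by (intro exI[of _ p]) auto
next
  assume "\<exists>p. approximates n p f \<and> rpoly_degree p \<le> D"
  then obtain p where p: "approximates n p f" "rpoly_degree p \<le> D" by blast
  then show "approx n D (1 / 3) f"
    unfolding approx_def approximates_def bits_def
    by (intro exI[of _ "\<lambda>x. rpoly_eval p (\<lambda>i. of_bool (x ! i))"])
       (auto intro: low_degree_weaken[OF low_degree_rpoly])
qed

text \<open>The \<open>LEAST\<close> is attained because interpolation gives an approximation of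
  degree \<open>n\<close>. From here on the approximate degree is handled through
  \<open>approx\<close>.\<close>

lemma adeg_le_iff: "adeg n f \<le> D \<longleftrightarrow> approx n D (1 / 3) f"
proof
  assume le: "adeg n f \<le> D"
  have "\<exists>D p. approximates n p f \<and> rpoly_degree p = D"
    using approx_exact[of n f] unfolding approx_iff_rpoly by blast
  from LeastI_ex[OF this] show "approx n D (1 / 3) f"
    using le unfolding adeg_def[symmetric] approx_iff_rpoly by auto
next
  assume "approx n D (1 / 3) f"
  then obtain p where p: "approximates n p f" "rpoly_degree p \<le> D"
    unfolding approx_iff_rpoly by blast
  then have "adeg n f \<le> rpoly_degree p"
    unfolding adeg_def by (intro Least_le) auto
  then show "adeg n f \<le> D" using p by simp
qed

lemma approx_adeg: "approx n (adeg n f) (1 / 3) f"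
  using adeg_le_iff by blast

lemma adeg_le_arity: "adeg n f \<le> n"
  by (simp add: adeg_le_iff approx_exact)

lemma adeg_cong:
  assumes "\<And>x. x \<in> bits n \<Longrightarrow> f x = g x"
  shows "adeg n f = adeg n g"
proof -
  have "adeg n f \<le> D \<longleftrightarrow> adeg n g \<le> D" for D
    unfolding adeg_le_iff approx_def using assms by simp
  then show ?thesis by (meson order_antisym order_refl)
qed

section \<open>Error reduction from \<open>7 / 20\<close> to \<open>1 / 3\<close>\<close>

lemma smoothstep_bounds:
  fixes t u :: real
  assumes "0 \<le> t" "t \<le> u" "u \<le> 1"
  shows "0 \<le> 3 * t\<^sup>2 - 2 * t ^ 3" "3 * t\<^sup>2 - 2 * t ^ 3 \<le> 3 * u\<^sup>2 - 2 * u ^ 3"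
proof -
  have "0 \<le> t\<^sup>2 * (3 - 2 * t)" using assms by (intro mult_nonneg_nonneg) auto
  then show "0 \<le> 3 * t\<^sup>2 - 2 * t ^ 3" by (simp add: algebra_simps power2_eq_square power3_eq_cube)
  have sq: "u * u \<le> u" "t * t \<le> t" "t * u \<le> t"
    using assms mult_left_le[of u u] mult_left_le[of t t] mult_left_le[of u t] by auto
  \<comment> \<open>This product is the difference of the two cubic values; by \<open>sq\<close> its
    second factor is at least \<open>u - t\<close>.\<close>
  have "0 \<le> (u - t) * (3 * (u + t) - 2 * (u * u + u * t + t * t))"
    using assms sq by (intro mult_nonneg_nonneg) (auto simp: mult.commute)
  then show "3 * t\<^sup>2 - 2 * t ^ 3 \<le> 3 * u\<^sup>2 - 2 * u ^ 3"
    by (simp add: algebra_simps power2_eq_square power3_eq_cube)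
qed

text \<open>The value \<open>7 / 17\<close> is the rescaled error \<open>7 / 20\<close>. One
  application brings it below \<open>37 / 100\<close>, a second one below \<open>1 / 3\<close>; two
  cubic steps account for the degree factor 9.\<close>

lemma smoothstep_boost:
  fixes t :: real
  assumes "0 \<le> t" "t \<le> 7 / 17"
  defines "s \<equiv> 3 * t\<^sup>2 - 2 * t ^ 3"
  shows "0 \<le> 3 * s\<^sup>2 - 2 * s ^ 3" "3 * s\<^sup>2 - 2 * s ^ 3 \<le> 1 / 3"
proof -
  have s: "0 \<le> s" "s \<le> 37 / 100"
    using smoothstep_bounds[of t "7 / 17"] assms
    by (auto simp: power2_eq_square power3_eq_cube)
  then show "0 \<le> 3 * s\<^sup>2 - 2 * s ^ 3" "3 * s\<^sup>2 - 2 * s ^ 3 \<le> 1 / 3"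
    using smoothstep_bounds[of s "37 / 100"]
    by (auto simp: power2_eq_square power3_eq_cube)
qed

text \<open>The error is reduced by iterating the polynomial \<open>3t\<^sup>2 - 2t\<^sup>3\<close>, which pushes \<open>[0,1]\<close> away from
  \<open>1/2\<close>, after an affine map has moved the range of the approximant into \<open>[0,1]\<close>.\<close>

lemma approx_boost:
  assumes "approx n D (7 / 20) f"
  shows "approx n (9 * D) (1 / 3) f"
proof -
  obtain F where F: "low_degree n D F" "\<forall>x\<in>bits n. \<bar>F x - of_bool (f x)\<bar> \<le> 7 / 20"
    using assms unfolding approx_def by blast
  define A :: "real \<Rightarrow> real" where "A t = 3 * t\<^sup>2 - 2 * t ^ 3" for t
  have A_low: "low_degree n (3 * D') (\<lambda>x. A (G x))" if G: "low_degree n D' G" for D' G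
  proof -
    have 2: "low_degree n (3 * D') (\<lambda>x. 3 * (G x * G x))"
      using low_degree_weaken[OF low_degree_mult[OF G G], of "3 * D'"] low_degree_scale by simp
    have 3: "low_degree n (3 * D') (\<lambda>x. (- 2) * (G x * G x * G x))"
      by (intro low_degree_scale low_degree_weaken[OF low_degree_mult[OF low_degree_mult[OF G G] G]])
        simp
    from low_degree_add[OF 2 3] show ?thesis
      by (rule low_degree_cong) (simp add: A_def power2_eq_square power3_eq_cube)
  qed
  \<comment> \<open>This symmetry about \<open>1 / 2\<close> reduces the points where
    \<open>f\<close> is true to the case where it is false.\<close>
  have A_sym: "A (1 - t) = 1 - A t" for t
    by (simp add: A_def algebra_simps power2_eq_square power3_eq_cube)
  \<comment> \<open>The values of \<open>F\<close> lie in \<open>[- 7 / 20, 27 / 20]\<close>, an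
    interval of length \<open>17 / 10\<close>, which \<open>T\<close> maps onto
    \<open>[0, 1]\<close>.\<close>
  define T where "T x = 10 / 17 * (7 / 20 + F x)" for x
  have "low_degree n D T"
    unfolding T_def[abs_def] by (intro low_degree_scale low_degree_add low_degree_const F(1))
  from A_low[OF A_low[OF this]] have "low_degree n (9 * D) (\<lambda>x. A (A (T x)))"
    by simp
  moreover have "\<bar>A (A (T x)) - of_bool (f x)\<bar> \<le> 1 / 3" if "x \<in> bits n" for x
  proof -
    have F': "\<bar>F x - of_bool (f x)\<bar> \<le> 7 / 20" using F(2) that by blast
    show ?thesis
    proof (cases "f x")
      case False
      then have "0 \<le> T x" "T x \<le> 7 / 17"
        using F' by (auto simp: T_def)
      from smoothstep_boost[OF this] show ?thesis
        using False by (simp add: A_def)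
    next
      case True
      then have "F x - 1 \<le> 7 / 20" "1 - F x \<le> 7 / 20"
        using F' unfolding abs_le_iff by simp_all
      then have "0 \<le> 1 - T x" "1 - T x \<le> 7 / 17"
        by (simp_all add: T_def)
      from smoothstep_boost[OF this] have "0 \<le> A (A (1 - T x))" "A (A (1 - T x)) \<le> 1 / 3"
        by (auto simp: A_def)
      then show ?thesis
        using True by (simp add: A_sym)
    qed
  qed
  ultimately show ?thesis unfolding approx_def by blast
qed

section \<open>Blocks and composition\<close>

definition blk :: "nat \<Rightarrow> nat \<Rightarrow> bool list \<Rightarrow> bool list" where
  "blk m i x = take m (drop (i * m) x)"

lemma bcomp_blk: "bcomp n m f g x = f (map (\<lambda>i. g (blk m i x)) [0..<n])"
  by (simp add: bcomp_def blk_def)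

lemma block_bound: "i < n \<Longrightarrow> j < m \<Longrightarrow> i * m + j < n * (m::nat)"
proof -
  assume "i < n" "j < m"
  then have "i * m + j < Suc i * m" by simp
  also have "\<dots> \<le> n * m" using \<open>i < n\<close> by (intro mult_le_mono1) simp
  finally show ?thesis .
qed

lemma blk_bits:
  assumes "x \<in> bits (n * m)" "i < n"
  shows "blk m i x \<in> bits m"
proof -
  have "Suc i * m \<le> n * m" using assms(2) by (intro mult_le_mono1) simp
  then show ?thesis using assms by (simp add: bits_def blk_def)
qed

lemma blk_nth:
  assumes "x \<in> bits (n * m)" "i < n" "j < m"
  shows "blk m i x ! j = x ! (i * m + j)"
  using block_bound[OF assms(2,3)] assms by (simp add: blk_def bits_def)

lemma blk_blk:
  assumes "x \<in> bits (a * (b * m))" "i < a" "j < b"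
  shows "blk m j (blk (b * m) i x) = blk m (i * b + j) x"
proof (rule nth_equalityI)
  have x: "x \<in> bits ((a * b) * m)" using assms by (simp add: mult.assoc)
  have ij: "i * b + j < a * b" using assms block_bound by blast
  have 1: "blk m j (blk (b * m) i x) \<in> bits m"
    by (rule blk_bits[OF blk_bits[OF assms(1,2)] assms(3)])
  have 2: "blk m (i * b + j) x \<in> bits m"
    using blk_bits[OF x ij] .
  show "length (blk m j (blk (b * m) i x)) = length (blk m (i * b + j) x)"
    using 1 2 by (simp add: bits_def)
  fix l assume "l < length (blk m j (blk (b * m) i x))"
  then have l: "l < m" using 1 by (simp add: bits_def)
  have "blk m j (blk (b * m) i x) ! l = blk (b * m) i x ! (j * m + l)"
    by (rule blk_nth[OF blk_bits[OF assms(1,2)] assms(3) l])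
  also have "\<dots> = x ! (i * (b * m) + (j * m + l))"
    by (rule blk_nth[OF assms(1,2) block_bound[OF assms(3) l]])
  also have "\<dots> = blk m (i * b + j) x ! l"
    using blk_nth[OF x ij l] by (simp add: algebra_simps)
  finally show "blk m j (blk (b * m) i x) ! l = blk m (i * b + j) x ! l" .
qed

lemma blk_map:
  assumes "i < a"
  shows "blk b i (map \<phi> [0..<a * b]) = map (\<lambda>j. \<phi> (i * b + j)) [0..<b]"
proof (rule nth_equalityI)
  have "map \<phi> [0..<a * b] \<in> bits (a * b)" by (simp add: bits_def)
  from blk_bits[OF this assms] blk_nth[OF this assms]
  show "length (blk b i (map \<phi> [0..<a * b])) = length (map (\<lambda>j. \<phi> (i * b + j)) [0..<b])"
    "\<And>l. l < length (blk b i (map \<phi> [0..<a * b])) \<Longrightarrow>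
      blk b i (map \<phi> [0..<a * b]) ! l = map (\<lambda>j. \<phi> (i * b + j)) [0..<b] ! l"
    using block_bound[OF assms] by (auto simp: bits_def)
qed

lemma bcomp_assoc:
  assumes "x \<in> bits (a * (b * m))"
  shows "bcomp (a * b) m (bcomp a b f g) u x = bcomp a (b * m) f (bcomp b m g u) x"
proof -
  have "g (blk b i (map (\<lambda>l. u (blk m l x)) [0..<a * b])) = bcomp b m g u (blk (b * m) i x)"
    if i: "i < a" for i
  proof -
    have "map (\<lambda>j. u (blk m (i * b + j) x)) [0..<b] = map (\<lambda>j. u (blk m j (blk (b * m) i x))) [0..<b]"
      using blk_blk[OF assms i] by (intro map_cong) auto
    then show ?thesis unfolding bcomp_blk blk_map[OF i] by (rule arg_cong[of _ _ g])
  qed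
  then have "map (\<lambda>i. g (blk b i (map (\<lambda>l. u (blk m l x)) [0..<a * b]))) [0..<a]
      = map (\<lambda>i. bcomp b m g u (blk (b * m) i x)) [0..<a]"
    by (intro map_cong) auto
  then show ?thesis
    unfolding bcomp_blk[of "a * b"] bcomp_blk[of a] by (rule arg_cong[of _ _ f])
qed

lemma bcomp_cong:
  assumes "\<And>z. z \<in> bits n \<Longrightarrow> f z = f' z" "\<And>y. y \<in> bits m \<Longrightarrow> g y = g' y" "x \<in> bits (n * m)"
  shows "bcomp n m f g x = bcomp n m f' g' x"
proof -
  have "map (\<lambda>i. g (blk m i x)) [0..<n] = map (\<lambda>i. g' (blk m i x)) [0..<n]"
    using assms blk_bits by (intro map_cong) auto
  moreover have "map (\<lambda>i. g' (blk m i x)) [0..<n] \<in> bits n" by (simp add: bits_def)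
  ultimately show ?thesis using assms(1) unfolding bcomp_blk by presburger
qed

lemma bcomp_hd:
  assumes "x \<in> bits m"
  shows "bcomp (Suc 0) m hd g x = g x"
  using assms by (simp add: bcomp_def bits_def)

text \<open>The recursion peels off the outermost level only; this splits the tower at any level, so
  that some levels can be spent on amplification.\<close>

lemma biter_add:
  assumes "x \<in> bits (k ^ (a + b))"
  shows "biter k h (a + b) x = bcomp (k ^ a) (k ^ b) (biter k h a) (biter k h b) x"
  using assms
proof (induction a arbitrary: x)
  case 0
  then show ?case by (simp add: bcomp_hd)
next
  case (Suc a)
  have x: "x \<in> bits (k * (k ^ a * k ^ b))" using Suc.prems by (simp add: power_add)
  have "biter k h (Suc a + b) x = bcomp k (k ^ a * k ^ b) h (biter k h (a + b)) x"
    by (simp add: power_add)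
  also have "\<dots> = bcomp k (k ^ a * k ^ b) h (bcomp (k ^ a) (k ^ b) (biter k h a) (biter k h b)) x"
    using x Suc.IH by (intro bcomp_cong) (auto simp: power_add)
  also have "\<dots> = bcomp (k ^ Suc a) (k ^ b) (biter k h (Suc a)) (biter k h b) x"
    using bcomp_assoc[OF x] by simp
  finally show ?case .
qed

section \<open>Upper bounds and monotonicity of the approximate degree\<close>

lemma adeg_bcomp_le: "adeg (n * m) (bcomp n m f g) \<le> adeg n f * m"
proof -
  obtain F where F: "low_degree n (adeg n f) F" "\<forall>x\<in>bits n. \<bar>F x - of_bool (f x)\<bar> \<le> 1 / 3"
    using approx_adeg unfolding approx_def by blast
  \<comment> \<open>As a function of its own \<open>m\<close> bits, \<open>g\<close> is an exact
    polynomial of degree at most \<open>m\<close>, so substituting it into \<open>F\<close> costs a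
    factor \<open>m\<close> and no error.\<close>
  have "low_degree (n * m) m (\<lambda>x. of_bool (g (blk m i x)))" if i: "i < n" for i
  proof -
    have low: "low_degree (n * m) (m * 1)
        (\<lambda>x. (\<lambda>y. of_bool (g y)) (map (\<lambda>j. x ! (i * m + j)) [0..<m]))"
      using block_bound[OF i]
      by (intro low_degree_compose low_degree_exact low_degree_var) auto
    have "map (\<lambda>j. x ! (i * m + j)) [0..<m] = blk m i x" if x: "x \<in> bits (n * m)" for x
      using blk_bits[OF x i] blk_nth[OF x i]
      by (intro nth_equalityI) (auto simp: bits_def)
    with low_degree_cong[OF low] show ?thesis by simp
  qed
  then have "low_degree (n * m) (adeg n f * m) (\<lambda>x. F (map (\<lambda>i. g (blk m i x)) [0..<n]))"
    by (rule low_degree_compose[OF F(1)])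
  moreover have "\<bar>F (map (\<lambda>i. g (blk m i x)) [0..<n]) - of_bool (bcomp n m f g x)\<bar> \<le> 1 / 3" for x
    unfolding bcomp_blk by (rule F(2)[rule_format]) (simp add: bits_def)
  ultimately show ?thesis
    unfolding adeg_le_iff approx_def by (intro exI conjI ballI)
qed

text \<open>Renaming or identifying variables in an approximant of \<open>G\<close> raises neither
  its degree nor its error.\<close>

lemma adeg_substitution:
  assumes "\<And>i. i < N \<Longrightarrow> \<sigma> i < n"
    and "\<And>x. x \<in> bits n \<Longrightarrow> G (map (\<lambda>i. x ! \<sigma> i) [0..<N]) = f x"
  shows "adeg n f \<le> adeg N G"
proof -
  obtain F where F: "low_degree N (adeg N G) F" "\<forall>x\<in>bits N. \<bar>F x - of_bool (G x)\<bar> \<le> 1 / 3"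
    using approx_adeg unfolding approx_def by blast
  have "low_degree n (adeg N G * 1) (\<lambda>x. F (map (\<lambda>i. x ! \<sigma> i) [0..<N]))"
    using assms(1) by (intro low_degree_compose F low_degree_var)
  moreover have "\<bar>F (map (\<lambda>i. x ! \<sigma> i) [0..<N]) - of_bool (f x)\<bar> \<le> 1 / 3" if "x \<in> bits n" for x
    unfolding assms(2)[OF that, symmetric] by (rule F(2)[rule_format]) (simp add: bits_def)
  ultimately show ?thesis
    unfolding adeg_le_iff approx_def mult_1_right by blast
qed

lemma biter_const:
  assumes "\<And>b. h (replicate k b) = b"
  shows "biter k h d (replicate (k ^ d) b) = b"
proof (induction d)
  case (Suc d)
  let ?x = "replicate (k ^ Suc d) b"
  have "blk (k ^ d) i ?x = replicate (k ^ d) b" if "i < k" for i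
  proof -
    have "k ^ d \<le> (k - i) * k ^ d" using that by simp
    then show ?thesis by (simp add: blk_def diff_mult_distrib min_def)
  qed
  then have "map (\<lambda>i. biter k h d (blk (k ^ d) i ?x)) [0..<k] = map (\<lambda>i. b) [0..<k]"
    using Suc by (intro map_cong) auto
  then show ?case
    using assms by (simp add: bcomp_blk map_replicate_const)
qed simp

text \<open>Each bit of \<open>x\<close> is repeated over a whole block, and the tower returns that
  bit on a constant block. This serves the case of bounded depth.\<close>

lemma adeg_outer_le:
  assumes h: "\<And>b. h (replicate k b) = b" and k: "k > 0"
  shows "adeg n f \<le> adeg (n * k ^ d) (bcomp n (k ^ d) f (biter k h d))"
proof (rule adeg_substitution[where \<sigma> = "\<lambda>i. i div k ^ d"])
  fix i assume "i < n * k ^ d"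
  then show "i div k ^ d < n" by (simp add: less_mult_imp_div_less)
next
  fix x assume x: "x \<in> bits n"
  have "map (\<lambda>j. x ! ((i * k ^ d + j) div k ^ d)) [0..<k ^ d] = replicate (k ^ d) (x ! i)" for i
    using k by (intro nth_equalityI) auto
  then have "map (\<lambda>i. biter k h d (blk (k ^ d) i (map (\<lambda>i. x ! (i div k ^ d)) [0..<n * k ^ d]))) [0..<n]
      = map (\<lambda>i. x ! i) [0..<n]"
    by (intro map_cong) (auto simp: blk_map biter_const[of h, OF h])
  also have "\<dots> = x" using x map_nth by (auto simp: bits_def)
  finally show "bcomp n (k ^ d) f (biter k h d) (map (\<lambda>i. x ! (i div k ^ d)) [0..<n * k ^ d]) = f x"
    by (simp add: bcomp_blk)
qed

text \<open>All blocks receive the same \<open>x\<close>, so the tower sees a constant string and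
  returns \<open>g x\<close>.\<close>

lemma adeg_inner_le:
  assumes h: "\<And>b. h (replicate k b) = b"
  shows "adeg m g \<le> adeg (k ^ d * m) (bcomp (k ^ d) m (biter k h d) g)"
proof (rule adeg_substitution[where \<sigma> = "\<lambda>i. i mod m"])
  fix i assume "i < k ^ d * m"
  then show "i mod m < m" by (cases m) auto
next
  fix x assume x: "x \<in> bits m"
  have "map (\<lambda>j. x ! ((i * m + j) mod m)) [0..<m] = x" for i
    using x by (intro nth_equalityI) (auto simp: bits_def)
  then have "map (\<lambda>i. g (blk m i (map (\<lambda>i. x ! (i mod m)) [0..<k ^ d * m]))) [0..<k ^ d]
      = map (\<lambda>i. g x) [0..<k ^ d]"
    by (intro map_cong) (auto simp: blk_map)
  then show "bcomp (k ^ d) m (biter k h d) g (map (\<lambda>i. x ! (i mod m)) [0..<k ^ d * m]) = g x"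
    by (simp add: bcomp_blk map_replicate_const biter_const[of h, OF h])
qed

section \<open>Linear programming duality\<close>

text \<open>A pair \<open>(a, b)\<close> encodes the inequality \<open>(\<Sum>i. c i * a i) \<le> b\<close> in the unknowns \<open>c\<close>.\<close>

inductive_set cone :: "(('i \<Rightarrow> real) \<times> real) set \<Rightarrow> (('i \<Rightarrow> real) \<times> real) set"
  for Q where
  base: "q \<in> Q \<Longrightarrow> q \<in> cone Q"
| add: "(a, b) \<in> cone Q \<Longrightarrow> (a', b') \<in> cone Q \<Longrightarrow> (\<lambda>i. a i + a' i, b + b') \<in> cone Q"
| scale: "r \<ge> 0 \<Longrightarrow> (a, b) \<in> cone Q \<Longrightarrow> (\<lambda>i. r * a i, r * b) \<in> cone Q"

lemma cone_trans:
  assumes "q \<in> cone Q'" "Q' \<subseteq> cone Q"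
  shows "q \<in> cone Q"
  using assms by (induction rule: cone.induct) (auto intro: cone.intros)

lemma cone_coeff_zero:
  assumes "q \<in> cone Q" "\<And>q. q \<in> Q \<Longrightarrow> fst q j = 0"
  shows "fst q j = 0"
  using assms by (induction rule: cone.induct) auto

text \<open>Reads a certificate in the cone as nonnegative weights. They are indexed by the points
  of \<open>X\<close> rather than by inequalities, since \<open>f\<close> may send two points to one
  inequality.\<close>

lemma cone_image_weights:
  assumes "q \<in> cone (f ` X)" "finite X"
  shows "\<exists>w. (\<forall>x\<in>X. 0 \<le> w x) \<and> (\<forall>i. fst q i = (\<Sum>x\<in>X. w x * fst (f x) i)) \<and>
    snd q = (\<Sum>x\<in>X. w x * snd (f x))"
  using assms(1)
proof (induction rule: cone.induct)
  case (base q)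
  then obtain y where y: "y \<in> X" "q = f y" by blast
  have "(\<Sum>x\<in>X. of_bool (x = y) * h x) = h y" for h :: "_ \<Rightarrow> real"
  proof -
    have "(\<Sum>x\<in>X. of_bool (x = y) * h x) = (\<Sum>x\<in>X. if x = y then h x else 0)"
      by (intro sum.cong) auto
    then show ?thesis using y assms(2) by simp
  qed
  then show ?case using y by (intro exI[of _ "\<lambda>x. of_bool (x = y)"]) simp
next
  case (add a b a' b')
  then obtain w w' where
    "\<forall>x\<in>X. 0 \<le> w x" "\<forall>i. a i = (\<Sum>x\<in>X. w x * fst (f x) i)" "b = (\<Sum>x\<in>X. w x * snd (f x))"
    "\<forall>x\<in>X. 0 \<le> w' x" "\<forall>i. a' i = (\<Sum>x\<in>X. w' x * fst (f x) i)" "b' = (\<Sum>x\<in>X. w' x * snd (f x))"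
    by auto
  then show ?case
    by (intro exI[of _ "\<lambda>x. w x + w' x"]) (simp add: distrib_right sum.distrib)
next
  case (scale r a b)
  then obtain w where
    "\<forall>x\<in>X. 0 \<le> w x" "\<forall>i. a i = (\<Sum>x\<in>X. w x * fst (f x) i)" "b = (\<Sum>x\<in>X. w x * snd (f x))"
    by auto
  then show ?case using scale.hyps
    by (intro exI[of _ "\<lambda>x. r * w x"]) (simp add: sum_distrib_left mult.assoc)
qed

text \<open>Supplies the value of the eliminated variable between its lower and upper bounds; if one
  side is empty, the extreme bound of the other side serves.\<close>

lemma finite_sets_separated:
  fixes L U :: "real set"
  assumes "finite L" "finite U" "\<And>l u. l \<in> L \<Longrightarrow> u \<in> U \<Longrightarrow> l \<le> u"
  obtains t where "\<And>l. l \<in> L \<Longrightarrow> l \<le> t" "\<And>u. u \<in> U \<Longrightarrow> t \<le> u"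
proof (cases "L = {}")
  case True
  show thesis
  proof (cases "U = {}")
    case True
    with \<open>L = {}\<close> show thesis using that by blast
  next
    case False
    then show thesis using that[of "Min U"] \<open>L = {}\<close> assms(2) by simp
  qed
next
  case False
  then show thesis using that[of "Max L"] assms by simp
qed

text \<open>Farkas' lemma, by Fourier--Motzkin elimination of the variable \<open>j\<close>.\<close>

lemma farkas:
  assumes "finite I" "finite Q"
    and "\<nexists>c. \<forall>q\<in>Q. (\<Sum>i\<in>I. c i * fst q i) \<le> snd q"
  shows "\<exists>q\<in>cone Q. (\<forall>i\<in>I. fst q i = 0) \<and> snd q < 0"
  using assms
proof (induction I arbitrary: Q rule: finite_induct)
  case empty
  then obtain q where "q \<in> Q" "snd q < 0" by (auto simp: not_le)
  then show ?case by (auto intro: cone.base)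
next
  case (insert j I)
  \<comment> \<open>For \<open>p\<close> in \<open>P\<close> and \<open>n\<close> in
    \<open>N\<close>, the nonnegative multipliers \<open>- fst n j\<close> and
    \<open>fst p j\<close> cancel the unknown \<open>j\<close>.\<close>
  define comb :: "('a \<Rightarrow> real) \<times> real \<Rightarrow> ('a \<Rightarrow> real) \<times> real \<Rightarrow> ('a \<Rightarrow> real) \<times> real"
    where "comb p n = (\<lambda>i. (- fst n j) * fst p i + fst p j * fst n i,
      (- fst n j) * snd p + fst p j * snd n)" for p n
  \<comment> \<open>Solved for the unknown \<open>j\<close>, the inequalities in \<open>P\<close>
    are upper bounds, those in \<open>N\<close> lower bounds, and those in \<open>Z\<close> do not
    mention it.\<close>
  define P N Z where "P = {q\<in>Q. fst q j > 0}" "N = {q\<in>Q. fst q j < 0}" "Z = {q\<in>Q. fst q j = 0}"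
  define Q' where "Q' = Z \<union> (\<lambda>(p, n). comb p n) ` (P \<times> N)"
  have fin: "finite P" "finite N" "finite Q'"
    using insert.prems(1) by (auto simp: P_N_Z_def Q'_def)
  have Q'_cone: "Q' \<subseteq> cone Q"
  proof -
    have "comb p n \<in> cone Q" if "p \<in> P" "n \<in> N" for p n
    proof -
      have "(fst p, snd p) \<in> cone Q" "(fst n, snd n) \<in> cone Q" "- fst n j \<ge> 0" "fst p j \<ge> 0"
        using that by (auto simp: P_N_Z_def intro: cone.base)
      then show ?thesis unfolding comb_def by (intro cone.add cone.scale)
    qed
    then show ?thesis by (auto simp: Q'_def P_N_Z_def intro: cone.base)
  qed
  have "\<nexists>c. \<forall>q\<in>Q'. (\<Sum>i\<in>I. c i * fst q i) \<le> snd q"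
  proof
    assume "\<exists>c. \<forall>q\<in>Q'. (\<Sum>i\<in>I. c i * fst q i) \<le> snd q"
    then obtain c where c: "\<And>q. q \<in> Q' \<Longrightarrow> (\<Sum>i\<in>I. c i * fst q i) \<le> snd q" by blast
    \<comment> \<open>The room that \<open>q\<close> leaves for the term in the unknown
      \<open>j\<close>.\<close>
    define rest where "rest q = snd q - (\<Sum>i\<in>I. c i * fst q i)" for q :: "('a \<Rightarrow> real) \<times> real"
    have "rest n / fst n j \<le> rest p / fst p j" if "p \<in> P" "n \<in> N" for p n
    proof -
      have "comb p n \<in> Q'" using that by (auto simp: Q'_def)
      from c[OF this] have "0 \<le> (- fst n j) * rest p + fst p j * rest n"
        by (simp add: comb_def rest_def algebra_simps sum.distrib sum_subtractf sum_negf sum_distrib_left)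
      moreover have "fst p j > 0" "fst n j < 0" using that by (auto simp: P_N_Z_def)
      ultimately show ?thesis by (simp add: field_simps)
    qed
    then have "l \<le> u" if "l \<in> (\<lambda>q. rest q / fst q j) ` N" "u \<in> (\<lambda>q. rest q / fst q j) ` P" for l u
      using that by blast
    with finite_sets_separated[OF finite_imageI[OF fin(2)] finite_imageI[OF fin(1)]]
    obtain t where "\<And>l. l \<in> (\<lambda>q. rest q / fst q j) ` N \<Longrightarrow> l \<le> t"
      "\<And>u. u \<in> (\<lambda>q. rest q / fst q j) ` P \<Longrightarrow> t \<le> u"
      by blast
    then have t: "\<And>n. n \<in> N \<Longrightarrow> rest n / fst n j \<le> t" "\<And>p. p \<in> P \<Longrightarrow> t \<le> rest p / fst p j"
      by blast+
    have "(\<Sum>i\<in>insert j I. (c(j := t)) i * fst q i) \<le> snd q" if "q \<in> Q" for q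
    proof -
      have "(\<Sum>i\<in>I. (c(j := t)) i * fst q i) = (\<Sum>i\<in>I. c i * fst q i)"
        using insert.hyps by (intro sum.cong) auto
      moreover have "t * fst q j \<le> rest q"
      proof (cases "fst q j" "0 :: real" rule: linorder_cases)
        case less
        then show ?thesis using t(1)[of q] that by (simp add: P_N_Z_def field_simps)
      next
        case equal
        then show ?thesis using c[of q] that by (simp add: P_N_Z_def Q'_def rest_def)
      next
        case greater
        then show ?thesis using t(2)[of q] that by (simp add: P_N_Z_def field_simps)
      qed
      ultimately show ?thesis using insert.hyps by (simp add: rest_def)
    qed
    then show False using insert.prems(2) by blast
  qed
  from insert.IH[OF fin(3) this]
  obtain q where q: "q \<in> cone Q'" "\<forall>i\<in>I. fst q i = 0" "snd q < 0" by blast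
  have "fst q j = 0"
    using q(1) by (rule cone_coeff_zero) (auto simp: Q'_def P_N_Z_def comb_def)
  then show ?case using q cone_trans[OF q(1) Q'_cone] by blast
qed

section \<open>Separating pairs of distributions\<close>

definition expect :: "nat \<Rightarrow> (bool list \<Rightarrow> real) \<Rightarrow> (bool list \<Rightarrow> real) \<Rightarrow> real" where
  "expect M \<mu> F = (\<Sum>x\<in>bits M. \<mu> x * F x)"

definition distribution :: "nat \<Rightarrow> (bool list \<Rightarrow> real) \<Rightarrow> bool" where
  "distribution M \<mu> \<longleftrightarrow> (\<forall>x\<in>bits M. 0 \<le> \<mu> x) \<and> (\<Sum>x\<in>bits M. \<mu> x) = 1"

text \<open>A dual witness in probabilistic form: polynomials of degree below \<open>D\<close>
  cannot tell \<open>\<mu> False\<close> from \<open>\<mu> True\<close>, while \<open>G\<close> does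
  so with error \<open>\<epsilon>\<close>.\<close>

definition separates ::
  "nat \<Rightarrow> nat \<Rightarrow> real \<Rightarrow> boolfun \<Rightarrow> (bool \<Rightarrow> bool list \<Rightarrow> real) \<Rightarrow> bool" where
  "separates M D \<epsilon> G \<mu> \<longleftrightarrow> (\<forall>b. distribution M (\<mu> b)) \<and>
     (\<forall>S. S \<subseteq> {..<M} \<longrightarrow> card S < D \<longrightarrow> expect M (\<mu> False) (chi S) = expect M (\<mu> True) (chi S)) \<and>
     (\<forall>b. expect M (\<mu> b) (\<lambda>x. of_bool (G x \<noteq> b)) \<le> \<epsilon>)"

lemma expect_add: "expect M \<mu> (\<lambda>x. F x + G x) = expect M \<mu> F + expect M \<mu> G"
  by (simp add: expect_def distrib_left sum.distrib)

lemma expect_scale: "expect M \<mu> (\<lambda>x. r * F x) = r * expect M \<mu> F"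
  by (simp add: expect_def sum_distrib_left mult_ac)

lemma expect_sum: "expect M \<mu> (\<lambda>x. \<Sum>i\<in>A. F i x) = (\<Sum>i\<in>A. expect M \<mu> (F i))"
  unfolding expect_def sum_distrib_left by (rule sum.swap)

lemma expect_const: "distribution M \<mu> \<Longrightarrow> expect M \<mu> (\<lambda>x. r) = r"
  by (simp add: expect_def distribution_def sum_distrib_right[symmetric])

lemma expect_mono:
  assumes "distribution M \<mu>" "\<And>x. x \<in> bits M \<Longrightarrow> F x \<le> G x"
  shows "expect M \<mu> F \<le> expect M \<mu> G"
  using assms unfolding expect_def distribution_def by (intro sum_mono mult_left_mono) auto

lemma expect_cong:
  assumes "\<And>x. x \<in> bits M \<Longrightarrow> F x = G x"
  shows "expect M \<mu> F = expect M \<mu> G"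
  using assms unfolding expect_def by (intro sum.cong) auto

text \<open>Approximability in degree \<open>D\<close> is a linear system in the coefficients of the
  monomials. The Farkas multipliers of the infeasible system, split by the side of the inequality
  and normalised, are the two distributions.\<close>

lemma separates_of_not_approx:
  assumes "\<not> approx m D (1 / 3) g"
  shows "\<exists>\<mu>. separates m (Suc D) (1 / 3) g \<mu>"
proof -
  define I where "I = {S. S \<subseteq> {..<m} \<and> card S \<le> D}"
  \<comment> \<open>\<open>True\<close> marks the lower bound \<open>g x - 1 / 3 \<le> F x\<close>,
    \<open>False\<close> the upper bound \<open>F x \<le> g x + 1 / 3\<close>.\<close>
  define row :: "bool list \<times> bool \<Rightarrow> (nat set \<Rightarrow> real) \<times> real" where
    "row = (\<lambda>(x, b). if b then (\<lambda>S. - chi S x, 1 / 3 - of_bool (g x))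
                          else (\<lambda>S. chi S x, 1 / 3 + of_bool (g x)))"
  define X where "X = bits m \<times> (UNIV :: bool set)"
  have X_sum: "(\<Sum>y\<in>X. F y) = (\<Sum>x\<in>bits m. F (x, True)) + (\<Sum>x\<in>bits m. F (x, False))"
    for F :: "bool list \<times> bool \<Rightarrow> real"
    unfolding X_def using sum.cartesian_product[of "\<lambda>x b. F (x, b)" UNIV "bits m"]
    by (simp add: UNIV_bool sum.distrib)
  have "\<nexists>c. \<forall>q\<in>row ` X. (\<Sum>S\<in>I. c S * fst q S) \<le> snd q"
  proof
    assume "\<exists>c. \<forall>q\<in>row ` X. (\<Sum>S\<in>I. c S * fst q S) \<le> snd q"
    then obtain c where c: "\<And>y. y \<in> X \<Longrightarrow> (\<Sum>S\<in>I. c S * fst (row y) S) \<le> snd (row y)" by blast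
    define F where "F x = (\<Sum>S\<in>I. c S * chi S x)" for x
    have "low_degree m D F" unfolding low_degree_def F_def I_def by blast
    moreover have "\<bar>F x - of_bool (g x)\<bar> \<le> 1 / 3" if "x \<in> bits m" for x
    proof -
      have "- F x \<le> 1 / 3 - of_bool (g x)" "F x \<le> 1 / 3 + of_bool (g x)"
        using c[of "(x, True)"] c[of "(x, False)"] that
        by (simp_all add: X_def row_def F_def sum_negf)
      then show ?thesis by linarith
    qed
    ultimately show False using assms unfolding approx_def by blast
  qed
  moreover have "finite I" "finite (row ` X)" by (simp_all add: I_def X_def)
  ultimately obtain q where q: "q \<in> cone (row ` X)" "\<forall>S\<in>I. fst q S = 0" "snd q < 0"
    using farkas by blast
  then obtain w where w: "\<forall>y\<in>X. 0 \<le> w y" "\<forall>S. fst q S = (\<Sum>y\<in>X. w y * fst (row y) S)"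
    "snd q = (\<Sum>y\<in>X. w y * snd (row y))"
    using cone_image_weights[of q row X] by (auto simp: X_def)
  define \<nu> where "\<nu> b x = w (x, b)" for b x
  have \<nu>_nonneg: "0 \<le> \<nu> b x" if "x \<in> bits m" for b x
    using w(1) that by (simp add: \<nu>_def X_def)
  have moments: "expect m (\<nu> False) (chi S) = expect m (\<nu> True) (chi S)" if "S \<in> I" for S
    using q(2) w(2) that unfolding X_sum
    by (simp add: row_def \<nu>_def expect_def sum_negf)
  define T where "T = (\<Sum>x\<in>bits m. \<nu> True x)"
  \<comment> \<open>The empty monomial shows that both sides carry the same mass.\<close>
  have "{} \<in> I" by (simp add: I_def)
  from moments[OF this] have T: "(\<Sum>x\<in>bits m. \<nu> b x) = T" for b
    by (cases b) (simp_all add: T_def expect_def)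
  have bad: "(\<Sum>x\<in>bits m. \<nu> True x * (1 / 3 - of_bool (g x)))
      + (\<Sum>x\<in>bits m. \<nu> False x * (1 / 3 + of_bool (g x))) < 0"
    using q(3) unfolding w(3) X_sum by (simp add: row_def \<nu>_def)
  have "T \<ge> 0" unfolding T_def using \<nu>_nonneg by (intro sum_nonneg) auto
  moreover have "T \<noteq> 0"
  proof
    assume "T = 0"
    then have "\<nu> b x = 0" if "x \<in> bits m" for b x
      using T[of b] \<nu>_nonneg that by (simp add: sum_nonneg_eq_0_iff)
    then show False using bad by simp
  qed
  ultimately have "T > 0" by simp
  define \<mu> where "\<mu> b x = inverse T * \<nu> b x" for b x
  have \<mu>_expect: "expect m (\<mu> b) F = inverse T * expect m (\<nu> b) F" for b F
    by (simp add: \<mu>_def expect_def sum_distrib_left mult.assoc)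
  have dist: "distribution m (\<mu> b)" for b
    using \<open>T > 0\<close> \<nu>_nonneg T[of b] by (simp add: distribution_def \<mu>_def sum_distrib_left[symmetric])
  define e where "e b = expect m (\<mu> b) (\<lambda>x. of_bool (g x))" for b
  \<comment> \<open>Dividing \<open>bad\<close> by \<open>T\<close> gives
    \<open>1 / 3 - e True + 1 / 3 + e False < 0\<close>. As both values lie in
    \<open>[0, 1]\<close>, each error is then below \<open>1 / 3\<close>.\<close>
  have eTF: "e True - e False > 2 / 3"
  proof -
    have "expect m (\<nu> True) (\<lambda>x. 1 / 3 - of_bool (g x))
        + expect m (\<nu> False) (\<lambda>x. 1 / 3 + of_bool (g x)) < 0"
      using bad by (simp add: expect_def)
    then have "inverse T * (expect m (\<nu> True) (\<lambda>x. 1 / 3 - of_bool (g x))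
        + expect m (\<nu> False) (\<lambda>x. 1 / 3 + of_bool (g x))) < 0"
      using \<open>T > 0\<close> by (intro mult_pos_neg) auto
    then have "expect m (\<mu> True) (\<lambda>x. 1 / 3 + (- 1) * of_bool (g x))
        + expect m (\<mu> False) (\<lambda>x. 1 / 3 + of_bool (g x)) < 0"
      by (simp add: \<mu>_expect distrib_left)
    then show ?thesis
      unfolding expect_add expect_scale expect_const[OF dist] by (simp add: e_def)
  qed
  have e_bounds: "0 \<le> e b" "e b \<le> 1" for b
    using expect_mono[OF dist, of "\<lambda>x. 0" "\<lambda>x. of_bool (g x)" b]
      expect_mono[OF dist, of "\<lambda>x. of_bool (g x)" "\<lambda>x. 1" b]
    by (simp_all add: e_def expect_const[OF dist])
  have "expect m (\<mu> True) (\<lambda>x. of_bool (g x \<noteq> True))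
      = expect m (\<mu> True) (\<lambda>x. 1 + (- 1) * of_bool (g x))"
    by (intro expect_cong) auto
  then have "expect m (\<mu> True) (\<lambda>x. of_bool (g x \<noteq> True)) = 1 - e True"
    unfolding expect_add expect_scale expect_const[OF dist] by (simp add: e_def)
  moreover have "expect m (\<mu> False) (\<lambda>x. of_bool (g x \<noteq> False)) = e False"
    by (simp add: e_def)
  ultimately have "expect m (\<mu> b) (\<lambda>x. of_bool (g x \<noteq> b)) \<le> 1 / 3" for b
    using eTF e_bounds[of False] e_bounds[of True] by (cases b) auto
  then have "separates m (Suc D) (1 / 3) g \<mu>"
    unfolding separates_def using dist moments by (auto simp: \<mu>_expect I_def)
  then show ?thesis by blast
qed

section \<open>Product distributions\<close>

text \<open>Independent blocks, each with its own weights, so that the law of block \<open>i\<close>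
  can follow a bit \<open>z ! i\<close>.\<close>

definition prod_weights :: "nat \<Rightarrow> nat \<Rightarrow> (nat \<Rightarrow> bool list \<Rightarrow> real) \<Rightarrow> bool list \<Rightarrow> real" where
  "prod_weights n m \<nu> x = (\<Prod>i<n. \<nu> i (blk m i x))"

lemma sum_bits_append: "(\<Sum>x\<in>bits (a + b). F x) = (\<Sum>y\<in>bits a. \<Sum>z\<in>bits b. F (y @ z))"
  unfolding sum.cartesian_product
  by (rule sum.reindex_bij_witness[where i = "\<lambda>(y, z). y @ z" and j = "\<lambda>x. (take a x, drop a x)"])
     (auto simp: bits_def)

text \<open>Fubini for independent blocks, by an induction that splits off the first block and
  shifts the others.\<close>

lemma sum_prod_blocks:
  "(\<Sum>x\<in>bits (n * m). \<Prod>i<n. \<phi> i (blk m i x)) = (\<Prod>i<n. \<Sum>y\<in>bits m. \<phi> i y :: real)"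
proof (induction n arbitrary: \<phi>)
  case 0
  then show ?case by (simp add: bits_def)
next
  case (Suc n)
  have "(\<Sum>x\<in>bits (Suc n * m). \<Prod>i<Suc n. \<phi> i (blk m i x))
      = (\<Sum>y\<in>bits m. \<Sum>z\<in>bits (n * m). \<Prod>i<Suc n. \<phi> i (blk m i (y @ z)))"
    by (simp add: sum_bits_append del: prod.lessThan_Suc)
  also have "\<dots> = (\<Sum>y\<in>bits m. \<Sum>z\<in>bits (n * m). \<phi> 0 y * (\<Prod>i<n. \<phi> (Suc i) (blk m i z)))"
    by (intro sum.cong refl) (simp add: prod.lessThan_Suc_shift blk_def bits_def del: prod.lessThan_Suc)
  also have "\<dots> = (\<Sum>y\<in>bits m. \<phi> 0 y) * (\<Prod>i<n. \<Sum>y\<in>bits m. \<phi> (Suc i) y)"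
    using Suc.IH[of "\<lambda>i. \<phi> (Suc i)"]
    by (simp add: sum_distrib_left[symmetric] sum_distrib_right[symmetric])
  also have "\<dots> = (\<Prod>i<Suc n. \<Sum>y\<in>bits m. \<phi> i y)"
    by (simp add: prod.lessThan_Suc_shift del: prod.lessThan_Suc)
  finally show ?case .
qed

lemma expect_prod:
  "expect (n * m) (prod_weights n m \<nu>) (\<lambda>x. \<Prod>i<n. \<phi> i (blk m i x))
     = (\<Prod>i<n. expect m (\<nu> i) (\<phi> i))"
  unfolding expect_def prod_weights_def sum_prod_blocks[symmetric] by (simp add: prod.distrib)

lemma distribution_prod:
  assumes "\<And>i. i < n \<Longrightarrow> distribution m (\<nu> i)"
  shows "distribution (n * m) (prod_weights n m \<nu>)"
  unfolding distribution_def
proof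
  show "\<forall>x\<in>bits (n * m). 0 \<le> prod_weights n m \<nu> x"
    using assms blk_bits unfolding prod_weights_def distribution_def
    by (auto intro!: prod_nonneg)
  have "(\<Sum>x\<in>bits (n * m). prod_weights n m \<nu> x) = (\<Prod>i<n. \<Sum>y\<in>bits m. \<nu> i y)"
    unfolding prod_weights_def by (rule sum_prod_blocks)
  also have "\<dots> = 1"
    using assms by (intro prod.neutral) (auto simp: distribution_def)
  finally show "(\<Sum>x\<in>bits (n * m). prod_weights n m \<nu> x) = 1" .
qed

lemma expect_block:
  assumes "\<And>i. i < n \<Longrightarrow> distribution m (\<nu> i)" "j < n"
  shows "expect (n * m) (prod_weights n m \<nu>) (\<lambda>x. F (blk m j x)) = expect m (\<nu> j) F"
proof -
  have "expect (n * m) (prod_weights n m \<nu>) (\<lambda>x. F (blk m j x))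
      = expect (n * m) (prod_weights n m \<nu>) (\<lambda>x. \<Prod>i<n. if i = j then F (blk m i x) else 1)"
    using assms(2) by (intro expect_cong) (simp add: prod.delta)
  also have "\<dots> = (\<Prod>i<n. expect m (\<nu> i) (\<lambda>y. if i = j then F y else 1))"
    by (rule expect_prod)
  also have "\<dots> = (\<Prod>i<n. if i = j then expect m (\<nu> i) F else 1)"
    using assms(1) by (intro prod.cong refl) (auto simp: expect_const)
  also have "\<dots> = expect m (\<nu> j) F"
    using assms(2) by (simp add: prod.delta)
  finally show ?thesis .
qed

definition slice :: "nat \<Rightarrow> nat set \<Rightarrow> nat \<Rightarrow> nat set" where
  "slice m S i = {j. j < m \<and> i * m + j \<in> S}"

lemma slice_subset: "slice m S i \<subseteq> {..<m}"
  by (auto simp: slice_def)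

text \<open>A monomial factors over the blocks, since division with remainder by \<open>m\<close>
  locates each position of \<open>S\<close> in its block.\<close>

lemma chi_blocks:
  assumes "S \<subseteq> {..<n * m}" "x \<in> bits (n * m)"
  shows "chi S x = (\<Prod>i<n. chi (slice m S i) (blk m i x))"
proof -
  have "(\<forall>s\<in>S. x ! s) \<longleftrightarrow> (\<forall>i<n. \<forall>j\<in>slice m S i. blk m i x ! j)"
  proof
    assume "\<forall>s\<in>S. x ! s"
    then show "\<forall>i<n. \<forall>j\<in>slice m S i. blk m i x ! j"
      using assms(2) by (auto simp: slice_def blk_nth)
  next
    assume *: "\<forall>i<n. \<forall>j\<in>slice m S i. blk m i x ! j"
    show "\<forall>s\<in>S. x ! s"
    proof
      fix s assume "s \<in> S"
      then have s: "s < n * m" using assms(1) by auto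
      then have sn: "s div m < n" by (simp add: less_mult_imp_div_less)
      have sm: "s mod m < m" using s by (cases "m = 0") auto
      have "s mod m \<in> slice m S (s div m)"
        using sm \<open>s \<in> S\<close> by (simp add: slice_def)
      then have "blk m (s div m) x ! (s mod m)" using * sn by blast
      then show "x ! s" using blk_nth[OF assms(2) sn sm] by simp
    qed
  qed
  moreover have "(\<Prod>i<n. of_bool (P i) :: real) = of_bool (\<forall>i<n. P i)" for P and n :: nat
    by (induction n) (auto simp: less_Suc_eq)
  ultimately show ?thesis by (simp add: chi_def)
qed

lemma sum_card_slice:
  assumes "S \<subseteq> {..<n * m}"
  shows "(\<Sum>i<n. card (slice m S i)) \<le> card S"
proof -
  have fin: "finite S" using assms finite_subset by blast
  have "(\<Sum>i<n. card (slice m S i)) = card (SIGMA i:{..<n}. slice m S i)"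
    using finite_subset[OF slice_subset] by (intro card_SigmaI[symmetric]) auto
  also have "\<dots> = card ((\<lambda>(i, j). i * m + j) ` (SIGMA i:{..<n}. slice m S i))"
  proof (rule card_image[symmetric], rule inj_onI)
    fix p q assume "p \<in> (SIGMA i:{..<n}. slice m S i)" "q \<in> (SIGMA i:{..<n}. slice m S i)"
      and eq: "(\<lambda>(i, j). i * m + j) p = (\<lambda>(i, j). i * m + j) q"
    then have "snd p < m" "snd q < m" by (auto simp: slice_def)
    moreover have "fst p * m + snd p = fst q * m + snd q" using eq by (simp add: case_prod_beta)
    ultimately show "p = q"
      by (metis add.commute div_mult_self3 mod_mult_self3 mod_less prod.expand div_less
          add_0 less_nat_zero_code)
  qed
  also have "\<dots> \<le> card S"
    using fin by (intro card_mono) (auto simp: slice_def)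
  finally show ?thesis .
qed

lemma card_slice_le:
  assumes "S \<subseteq> {..<n * m}" "i < n"
  shows "card (slice m S i) \<le> card S"
  using sum_card_slice[OF assms(1)] member_le_sum[of i "{..<n}" "\<lambda>i. card (slice m S i)"] assms(2)
  by simp

lemma expect_chi_prod:
  assumes "S \<subseteq> {..<n * m}"
  shows "expect (n * m) (prod_weights n m \<nu>) (chi S) = (\<Prod>i<n. expect m (\<nu> i) (chi (slice m S i)))"
proof -
  have "expect (n * m) (prod_weights n m \<nu>) (chi S)
      = expect (n * m) (prod_weights n m \<nu>) (\<lambda>x. \<Prod>i<n. chi (slice m S i) (blk m i x))"
    using assms by (intro expect_cong chi_blocks)
  also have "\<dots> = (\<Prod>i<n. expect m (\<nu> i) (chi (slice m S i)))"
    by (rule expect_prod)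
  finally show ?thesis .
qed

section \<open>Amplification by the recursive function\<close>

text \<open>\<open>amp p\<close> bounds the probability that one level of \<open>h\<close> errs when each of its inputs errs
  independently with probability \<open>p\<close>.\<close>

definition amp :: "real \<Rightarrow> real" where
  "amp p = (p * (2 - p))\<^sup>2"

definition amplifies :: "nat \<Rightarrow> boolfun \<Rightarrow> bool" where
  "amplifies k h \<longleftrightarrow> (\<forall>p b. 0 \<le> p \<longrightarrow> p \<le> 1 \<longrightarrow>
     (\<Sum>z\<in>bits k. of_bool (h z \<noteq> b) * (\<Prod>i<k. if z ! i \<noteq> b then p else 1 - p)) \<le> amp p)"

lemma bits_0: "bits 0 = {[]}"
  by (auto simp: bits_def)

lemma sum_bits_Suc:
  "(\<Sum>z\<in>bits (Suc n). F z) = (\<Sum>z\<in>bits n. F (True # z)) + (\<Sum>z\<in>bits n. F (False # z))"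
proof -
  have "bits 1 = {[True], [False]}"
    by (auto simp: bits_def length_Suc_conv)
  then show ?thesis using sum_bits_append[of F 1 n] by simp
qed

text \<open>At least two of three inputs err with probability
  \<open>3 * p\<^sup>2 - 2 * p ^ 3\<close>, which is \<open>p\<^sup>2 * (1 - p)\<^sup>2\<close> less
  than \<open>amp p\<close>.\<close>

lemma amplifies_maj3: "amplifies 3 maj3"
  unfolding amplifies_def
proof (intro allI impI)
  fix p :: real and b
  have "(\<Sum>z\<in>bits 3. of_bool (maj3 z \<noteq> b) * (\<Prod>i<3. if z ! i \<noteq> b then p else 1 - p))
      = 3 * p\<^sup>2 - 2 * p ^ 3"
    by (cases b) (simp_all add: numeral_3_eq_3 sum_bits_Suc bits_0 maj3_def
        algebra_simps power2_eq_square)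
  also have "\<dots> \<le> amp p"
  proof -
    have "amp p - (3 * p\<^sup>2 - 2 * p ^ 3) = p\<^sup>2 * (1 - p)\<^sup>2"
      by (simp add: amp_def algebra_simps power2_eq_square power3_eq_cube)
    moreover have "0 \<le> p\<^sup>2 * (1 - p)\<^sup>2" by simp
    ultimately show ?thesis by linarith
  qed
  finally show "(\<Sum>z\<in>bits 3. of_bool (maj3 z \<noteq> b) * (\<Prod>i<3. if z ! i \<noteq> b then p else 1 - p)) \<le> amp p" .
qed

lemma and2_or2_iff: "and2_or2 [a, b, c, d] \<longleftrightarrow> (a \<or> b) \<and> (c \<or> d)"
  by (simp add: and2_or2_def bcomp_def and2_def or2_def upt_rec)

text \<open>For \<open>b\<close> false an error means that both disjunctions are true, with
  probability exactly \<open>amp p\<close>. For \<open>b\<close> true some disjunction is false,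
  with probability \<open>2 * p\<^sup>2 - p ^ 4\<close>, which is no larger.\<close>

lemma amplifies_and2_or2: "amplifies 4 and2_or2"
  unfolding amplifies_def
proof (intro allI impI)
  fix p :: real and b
  have four: "4 = Suc (Suc (Suc (Suc 0)))" by simp
  have "(\<Sum>z\<in>bits 4. of_bool (and2_or2 z \<noteq> b) * (\<Prod>i<4. if z ! i \<noteq> b then p else 1 - p))
      = (if b then 2 * p\<^sup>2 - p ^ 4 else amp p)"
    unfolding four
    by (cases b) (simp_all add: sum_bits_Suc bits_0 and2_or2_iff amp_def
        algebra_simps power2_eq_square)
  also have "\<dots> \<le> amp p"
  proof -
    have "amp p - (2 * p\<^sup>2 - p ^ 4) = 2 * (p\<^sup>2 * (1 - p)\<^sup>2)"
      by (simp add: amp_def algebra_simps power2_eq_square power4_eq_xxxx)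
    moreover have "0 \<le> p\<^sup>2 * (1 - p)\<^sup>2" by simp
    ultimately have "2 * p\<^sup>2 - p ^ 4 \<le> amp p" by linarith
    then show ?thesis by simp
  qed
  finally show "(\<Sum>z\<in>bits 4. of_bool (and2_or2 z \<noteq> b) * (\<Prod>i<4. if z ! i \<noteq> b then p else 1 - p)) \<le> amp p" .
qed

lemma amp_mono:
  assumes "0 \<le> p" "p \<le> q" "q \<le> 1"
  shows "amp p \<le> amp q"
proof -
  have "0 \<le> (q - p) * (2 - q - p)" using assms by (intro mult_nonneg_nonneg) auto
  then have "p * (2 - p) \<le> q * (2 - q)" by (simp add: algebra_simps)
  then show ?thesis unfolding amp_def using assms by (intro power_mono mult_nonneg_nonneg) auto
qed

lemma amp_bounds:
  assumes "0 \<le> p" "p \<le> 1"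
  shows "0 \<le> amp p" "amp p \<le> 1"
  using amp_mono[of 0 p] amp_mono[of p 1] assms by (auto simp: amp_def)

text \<open>The slices of a small \<open>S\<close> are small, so all factors of its expectation
  agree. The blocks err independently with one common probability, the situation that
  \<open>amplifies\<close> describes.\<close>

lemma separates_amplify:
  assumes sep: "separates M D \<epsilon> G \<mu>" and h: "amplifies k h" and \<epsilon>: "\<epsilon> \<le> 1"
  shows "separates (k * M) D (amp \<epsilon>) (bcomp k M h G) (\<lambda>b. prod_weights k M (\<lambda>i. \<mu> b))"
proof -
  have dist: "distribution M (\<mu> b)" for b using sep by (simp add: separates_def)
  have "expect (k * M) (prod_weights k M (\<lambda>i. \<mu> False)) (chi S)
      = expect (k * M) (prod_weights k M (\<lambda>i. \<mu> True)) (chi S)"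
    if S: "S \<subseteq> {..<k * M}" "card S < D" for S
  proof -
    have "expect M (\<mu> False) (chi (slice M S i)) = expect M (\<mu> True) (chi (slice M S i))"
      if "i < k" for i
      using sep slice_subset card_slice_le[OF S(1) that] S(2) by (auto simp: separates_def)
    then show ?thesis unfolding expect_chi_prod[OF S(1)] by (intro prod.cong) auto
  qed
  moreover have "expect (k * M) (prod_weights k M (\<lambda>i. \<mu> b)) (\<lambda>x. of_bool (bcomp k M h G x \<noteq> b))
      \<le> amp \<epsilon>" for b
  proof -
    \<comment> \<open>The exact error probability of a block; monotonicity of \<open>amp\<close>
      passes to the bound \<open>\<epsilon>\<close> at the end.\<close>
    define p where "p = expect M (\<mu> b) (\<lambda>y. of_bool (G y \<noteq> b))"
    have p: "0 \<le> p" "p \<le> \<epsilon>"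
      using sep expect_mono[OF dist, of "\<lambda>x. 0" "\<lambda>y. of_bool (G y \<noteq> b)" b]
      by (auto simp: p_def separates_def expect_const[OF dist])
    have not_p: "expect M (\<mu> b) (\<lambda>y. of_bool (G y = b)) = 1 - p"
    proof -
      have "expect M (\<mu> b) (\<lambda>y. of_bool (G y = b) + of_bool (G y \<noteq> b)) = expect M (\<mu> b) (\<lambda>y. 1)"
        by (intro expect_cong) auto
      then show ?thesis by (simp add: expect_add expect_const[OF dist] p_def)
    qed
    \<comment> \<open>Summing over the patterns \<open>z\<close> of block values makes each summand
      a product over the blocks, so that independence applies.\<close>
    have expand: "(of_bool (bcomp k M h G x \<noteq> b) :: real)
        = (\<Sum>z\<in>bits k. of_bool (h z \<noteq> b) * (\<Prod>i<k. of_bool (G (blk M i x) = z ! i)))" for x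
    proof -
      let ?w = "map (\<lambda>i. G (blk M i x)) [0..<k]"
      have w: "?w \<in> bits k" by (simp add: bits_def)
      have "(\<Prod>i<k. of_bool (G (blk M i x) = z ! i)) = (of_bool (z = ?w) :: real)"
        if "z \<in> bits k" for z
        using that by (auto simp: bits_def list_eq_iff_nth_eq)
      then have *: "(\<Sum>z\<in>bits k. of_bool (h z \<noteq> b) * (\<Prod>i<k. of_bool (G (blk M i x) = z ! i)))
          = (\<Sum>z\<in>bits k. if z = ?w then of_bool (h z \<noteq> b) else (0 :: real))"
        by (intro sum.cong) auto
      show ?thesis unfolding * using w by (simp add: bcomp_blk)
    qed
    have "expect (k * M) (prod_weights k M (\<lambda>i. \<mu> b)) (\<lambda>x. of_bool (bcomp k M h G x \<noteq> b))
        = (\<Sum>z\<in>bits k. of_bool (h z \<noteq> b) * (\<Prod>i<k. expect M (\<mu> b) (\<lambda>y. of_bool (G y = z ! i))))"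
      unfolding expand expect_sum expect_scale
      using expect_prod[of k M "\<lambda>i. \<mu> b" "\<lambda>i y. of_bool (G y = _ ! i)"] by simp
    also have "\<dots> = (\<Sum>z\<in>bits k. of_bool (h z \<noteq> b) * (\<Prod>i<k. if z ! i \<noteq> b then p else 1 - p))"
    proof -
      have "expect M (\<mu> b) (\<lambda>y. of_bool (G y = c)) = (if c \<noteq> b then p else 1 - p)" for c
      proof (cases "c = b")
        case False
        then have "(G y = c) = (G y \<noteq> b)" for y by auto
        then show ?thesis using False by (simp add: p_def)
      qed (simp add: not_p)
      then show ?thesis by simp
    qed
    also have "\<dots> \<le> amp p" using h p \<epsilon> unfolding amplifies_def by auto
    also have "\<dots> \<le> amp \<epsilon>" using p \<epsilon> by (intro amp_mono)
    finally show ?thesis .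
  qed
  ultimately show ?thesis
    unfolding separates_def using distribution_prod[of k M "\<lambda>i. \<mu> b" for b] dist by blast
qed

lemma separates_cong:
  assumes "separates M D \<epsilon> G \<mu>" "\<And>x. x \<in> bits M \<Longrightarrow> G x = G' x"
  shows "separates M D \<epsilon> G' \<mu>"
proof -
  have "expect M (\<mu> b) (\<lambda>x. of_bool (G x \<noteq> b)) = expect M (\<mu> b) (\<lambda>x. of_bool (G' x \<noteq> b))" for b
    using assms(2) by (intro expect_cong) simp
  then show ?thesis using assms(1) by (simp add: separates_def)
qed

lemma amp_iter_bounds: "0 \<le> (amp ^^ a) (1 / 3)" "(amp ^^ a) (1 / 3) \<le> 1"
  by (induction a) (auto intro: amp_bounds)

lemma separates_biter:
  assumes "separates m D (1 / 3) g \<mu>" "amplifies k h"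
  shows "\<exists>\<mu>'. separates (k ^ a * m) D ((amp ^^ a) (1 / 3)) (bcomp (k ^ a) m (biter k h a) g) \<mu>'"
proof (induction a)
  case 0
  have "separates m D (1 / 3) (bcomp (Suc 0) m hd g) \<mu>"
    using assms(1) by (rule separates_cong) (simp add: bcomp_hd)
  then show ?case by auto
next
  case (Suc a)
  then obtain \<mu>' where
    "separates (k ^ a * m) D ((amp ^^ a) (1 / 3)) (bcomp (k ^ a) m (biter k h a) g) \<mu>'" by blast
  from separates_amplify[OF this assms(2) amp_iter_bounds(2)]
  have "separates (k * (k ^ a * m)) D ((amp ^^ Suc a) (1 / 3))
      (bcomp k (k ^ a * m) h (bcomp (k ^ a) m (biter k h a) g))
      (\<lambda>b. prod_weights k (k ^ a * m) (\<lambda>i. \<mu>' b))" by simp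
  then have "separates (k * (k ^ a * m)) D ((amp ^^ Suc a) (1 / 3))
      (bcomp (k ^ Suc a) m (biter k h (Suc a)) g)
      (\<lambda>b. prod_weights k (k ^ a * m) (\<lambda>i. \<mu>' b))"
    by (rule separates_cong) (simp add: bcomp_assoc)
  then show ?case by (auto simp: mult.assoc)
qed

text \<open>Below \<open>1/4\<close> each step at least squares \<open>4p\<close>, and \<open>1/3\<close> falls below \<open>1/8\<close> in five steps.\<close>

lemma amp_iter_decay: "(amp ^^ (j + 5)) (1 / 3) \<le> 1 / 4 * (1 / 2) ^ (2 ^ j)"
proof (induction j)
  case 0
  have step: "(amp ^^ Suc a) (1 / 3) \<le> r" if "(amp ^^ a) (1 / 3) \<le> q" "q \<le> 1" "amp q \<le> r" for a q r
    using amp_mono[OF amp_iter_bounds(1) that(1,2)] that(3) by simp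
  have "(amp ^^ Suc 0) (1 / 3) \<le> 31 / 100"
    by (rule step[of 0 "1 / 3"]) (simp_all add: amp_def power2_eq_square)
  then have "(amp ^^ Suc (Suc 0)) (1 / 3) \<le> 28 / 100"
    by (rule step) (simp_all add: amp_def power2_eq_square)
  then have "(amp ^^ Suc (Suc (Suc 0))) (1 / 3) \<le> 24 / 100"
    by (rule step) (simp_all add: amp_def power2_eq_square)
  then have "(amp ^^ Suc (Suc (Suc (Suc 0)))) (1 / 3) \<le> 18 / 100"
    by (rule step) (simp_all add: amp_def power2_eq_square)
  then have "(amp ^^ Suc (Suc (Suc (Suc (Suc 0))))) (1 / 3) \<le> 1 / 8"
    by (rule step) (simp_all add: amp_def power2_eq_square)
  then show ?case by (simp add: eval_nat_numeral)
next
  case (Suc j)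
  define p where "p = (amp ^^ (j + 5)) (1 / 3)"
  have p: "0 \<le> p" "p \<le> 1" "p \<le> 1 / 4 * (1 / 2) ^ (2 ^ j)"
    using amp_iter_bounds Suc by (auto simp: p_def)
  have "(amp ^^ (Suc j + 5)) (1 / 3) = amp p"
    by (simp only: p_def add_Suc funpow.simps o_apply)
  also have "\<dots> \<le> (p * 2)\<^sup>2"
    unfolding amp_def using p by (intro power_mono mult_left_mono mult_nonneg_nonneg) auto
  also have "\<dots> \<le> (1 / 4 * (1 / 2) ^ (2 ^ j) * 2)\<^sup>2"
    using p by (intro power_mono mult_right_mono) auto
  also have "\<dots> = 1 / 4 * (1 / 2) ^ (2 ^ Suc j)"
    by (simp add: power_mult_distrib power_mult[symmetric] mult.commute power_divide)
  finally show ?case .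
qed

section \<open>The lower bound for compositions\<close>

text \<open>The approximant of \<open>f\<close> is \<open>q z\<close>, the mean of \<open>F\<close>
  when block \<open>i\<close> is drawn from \<open>\<mu> (z ! i)\<close>. A union bound over the
  blocks gives the extra error \<open>n * \<epsilon>\<close>.\<close>

lemma approx_outer:
  assumes sep: "separates M D \<epsilon> G \<mu>" and D: "D > 0"
    and "approx (n * M) T \<delta> (bcomp n M f G)"
  shows "approx n (T div D) (\<delta> + n * \<epsilon>) f"
proof -
  obtain F where F: "low_degree (n * M) T F"
    "\<And>x. x \<in> bits (n * M) \<Longrightarrow> \<bar>F x - of_bool (bcomp n M f G x)\<bar> \<le> \<delta>"
    using assms(3) unfolding approx_def by blast
  have dist: "distribution M (\<mu> b)" for b using sep by (simp add: separates_def)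
  define W where "W z = prod_weights n M (\<lambda>i. \<mu> (z ! i))" for z :: "bool list"
  have W: "distribution (n * M) (W z)" for z
    unfolding W_def by (intro distribution_prod dist)
  define q where "q z = expect (n * M) (W z) F" for z
  have chi_low: "low_degree n (T div D) (\<lambda>z. expect (n * M) (W z) (chi S))"
    if S: "S \<subseteq> {..<n * M}" "card S \<le> T" for S
  proof -
    \<comment> \<open>The degree charged to block \<open>i\<close>: a slice smaller than
      \<open>D\<close> has the same expectation under both distributions, hence does not depend on
      \<open>z\<close>.\<close>
    define d where "d i = (of_bool (D \<le> card (slice M S i)) :: nat)" for i
    have factor: "low_degree n (d i) (\<lambda>z. expect M (\<mu> (z ! i)) (chi (slice M S i)))" if "i < n" for i
    proof (cases "D \<le> card (slice M S i)")
      case False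
      then have "expect M (\<mu> b) (chi (slice M S i)) = expect M (\<mu> True) (chi (slice M S i))" for b
        using sep slice_subset[of M S i] by (cases b) (auto simp: separates_def)
      then have "(\<lambda>z. expect M (\<mu> (z ! i)) (chi (slice M S i)))
          = (\<lambda>z. expect M (\<mu> True) (chi (slice M S i)))" by blast
      then show ?thesis by simp
    next
      case True
      define e where "e b = expect M (\<mu> b) (chi (slice M S i))" for b
      have "low_degree n 1 (\<lambda>z. e False + (e True - e False) * of_bool (z ! i))"
        by (intro low_degree_add low_degree_scale low_degree_const low_degree_var that)
      then have "low_degree n 1 (\<lambda>z. e (z ! i))"
        by (rule low_degree_cong) auto
      then show ?thesis using True by (simp add: d_def e_def)
    qed
    \<comment> \<open>Every charged block uses up at least \<open>D\<close> positions of
      \<open>S\<close>, so at most \<open>T div D\<close> blocks are charged.\<close>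
    have "(\<Sum>i<n. d i) * D \<le> (\<Sum>i<n. card (slice M S i))"
      unfolding sum_distrib_right by (intro sum_mono) (simp add: d_def)
    also have "\<dots> \<le> T" using sum_card_slice[OF S(1)] S(2) by simp
    finally have "(\<Sum>i<n. d i) \<le> T div D" using D by (simp add: less_eq_div_iff_mult_less_eq)
    moreover have "low_degree n (\<Sum>i<n. d i) (\<lambda>z. \<Prod>i<n. expect M (\<mu> (z ! i)) (chi (slice M S i)))"
      using factor by (intro low_degree_prod) auto
    ultimately show ?thesis
      unfolding W_def expect_chi_prod[OF S(1)] by (rule low_degree_weaken[rotated])
  qed
  have "low_degree n (T div D) q"
  proof -
    obtain c where c: "\<forall>x\<in>bits (n * M).
        F x = (\<Sum>S | S \<subseteq> {..<n * M} \<and> card S \<le> T. c S * chi S x)"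
      using F(1) unfolding low_degree_def by blast
    have "q z = (\<Sum>S | S \<subseteq> {..<n * M} \<and> card S \<le> T. c S * expect (n * M) (W z) (chi S))" for z
      unfolding q_def expect_scale[symmetric] expect_sum[symmetric]
      using c by (intro expect_cong) simp
    moreover have "low_degree n (T div D)
        (\<lambda>z. \<Sum>S | S \<subseteq> {..<n * M} \<and> card S \<le> T. c S * expect (n * M) (W z) (chi S))"
      using chi_low by (intro low_degree_sum low_degree_scale) auto
    ultimately show ?thesis by presburger
  qed
  moreover have "\<bar>q z - of_bool (f z)\<bar> \<le> \<delta> + n * \<epsilon>" if z: "z \<in> bits n" for z
  proof -
    \<comment> \<open>The number of wrong blocks. Once it is nonzero it is at least 1, which covers
      any change in the Boolean value of \<open>f\<close>.\<close>
    define err where "err x = (\<Sum>i<n. of_bool (G (blk M i x) \<noteq> z ! i) :: real)" for x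
    have pointwise: "\<bar>F x - of_bool (f z)\<bar> \<le> \<delta> + err x" if x: "x \<in> bits (n * M)" for x
    proof (cases "\<forall>i<n. G (blk M i x) = z ! i")
      case True
      then have "map (\<lambda>i. G (blk M i x)) [0..<n] = z"
        using z by (auto simp: bits_def list_eq_iff_nth_eq)
      then have "bcomp n M f G x = f z" by (simp add: bcomp_blk)
      moreover have "err x \<ge> 0" unfolding err_def by (intro sum_nonneg) auto
      ultimately show ?thesis using F(2)[OF x] by simp
    next
      case False
      then obtain i where i: "i < n" "G (blk M i x) \<noteq> z ! i" by blast
      then have "1 \<le> err x"
        using member_le_sum[of i "{..<n}" "\<lambda>i. of_bool (G (blk M i x) \<noteq> z ! i) :: real"]
        by (simp add: err_def)
      moreover have "\<bar>of_bool (bcomp n M f G x) - of_bool (f z)\<bar> \<le> (1 :: real)" by simp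
      ultimately show ?thesis using F(2)[OF x] by linarith
    qed
    have err_le: "expect (n * M) (W z) err \<le> n * \<epsilon>"
    proof -
      have "expect (n * M) (W z) err
          = (\<Sum>i<n. expect (n * M) (W z) (\<lambda>x. of_bool (G (blk M i x) \<noteq> z ! i)))"
        unfolding err_def expect_sum ..
      also have "\<dots> = (\<Sum>i<n. expect M (\<mu> (z ! i)) (\<lambda>y. of_bool (G y \<noteq> z ! i)))"
        unfolding W_def using expect_block[OF dist] by (intro sum.cong) auto
      also have "\<dots> \<le> (\<Sum>i<n. \<epsilon>)"
        using sep by (intro sum_mono) (auto simp: separates_def)
      finally show ?thesis by simp
    qed
    have "q z \<le> expect (n * M) (W z) (\<lambda>x. (of_bool (f z) + \<delta>) + err x)"
      unfolding q_def
    proof (intro expect_mono W)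
      fix x assume "x \<in> bits (n * M)"
      from pointwise[OF this] show "F x \<le> (of_bool (f z) + \<delta>) + err x" by linarith
    qed
    moreover have "expect (n * M) (W z) (\<lambda>x. (of_bool (f z) - \<delta>) + (- 1) * err x) \<le> q z"
      unfolding q_def
    proof (intro expect_mono W)
      fix x assume "x \<in> bits (n * M)"
      from pointwise[OF this] show "(of_bool (f z) - \<delta>) + (- 1) * err x \<le> F x" by linarith
    qed
    ultimately show ?thesis
      unfolding expect_add expect_scale expect_const[OF W] using err_le by linarith
  qed
  ultimately show ?thesis unfolding approx_def by blast
qed

text \<open>If \<open>adeg m g\<close> is positive, no approximation of \<open>g\<close> exists one
  degree lower, so duality and amplification supply a witness at \<open>adeg m g\<close> itself;
  averaging then gives an approximation of \<open>f\<close>, up to error reduction.\<close>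

lemma adeg_composition_lower:
  assumes h: "amplifies k h" and small: "real n * (amp ^^ a) (1 / 3) \<le> 1 / 60"
  shows "adeg n f * adeg m g
    \<le> 9 * adeg (n * (k ^ a * m)) (bcomp n (k ^ a * m) f (bcomp (k ^ a) m (biter k h a) g))"
    (is "_ \<le> 9 * ?T")
proof (cases "adeg m g")
  case (Suc D)
  then have "\<not> approx m D (1 / 3) g" using adeg_le_iff[of m g D] by simp
  then obtain \<mu> where
    "separates (k ^ a * m) (Suc D) ((amp ^^ a) (1 / 3)) (bcomp (k ^ a) m (biter k h a) g) \<mu>"
    using separates_of_not_approx separates_biter[OF _ h] by blast
  from approx_outer[OF this _ approx_adeg]
  have "approx n (?T div Suc D) (1 / 3 + n * (amp ^^ a) (1 / 3)) f" by simp
  \<comment> \<open>\<open>1 / 3 + 1 / 60 = 7 / 20\<close>, the error accepted by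
    \<open>approx_boost\<close>.\<close>
  then have "approx n (?T div Suc D) (7 / 20) f"
    using small unfolding approx_def by (fastforce intro: order_trans)
  then have "adeg n f \<le> 9 * (?T div Suc D)" unfolding adeg_le_iff by (rule approx_boost)
  then have "adeg n f * Suc D \<le> 9 * (?T div Suc D) * Suc D" by (rule mult_le_mono1)
  also have "\<dots> \<le> 9 * ?T" by (metis div_times_less_eq_dividend mult.assoc mult_le_mono2)
  finally show ?thesis using Suc by simp
qed simp

section \<open>Counting levels\<close>

lemma replicate_amplifier:
  assumes "(k, h) \<in> {(3, maj3), (4, and2_or2)}"
  shows "h (replicate k b) = b"
  using assms by (cases b) (auto simp: maj3_def and2_or2_iff numeral_eq_Suc)

text \<open>Five levels are the warm-up in \<open>amp_iter_decay\<close>; three more give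
  \<open>2 ^ j \<ge> 8 * log 2 n\<close>, hence an error of at most \<open>1 / 4\<close> times the
  inverse of \<open>n ^ 8\<close>.\<close>

definition levels :: "nat \<Rightarrow> nat" where
  "levels n = nat \<lceil>log 2 (log 2 n)\<rceil> + 8"

lemma levels_small:
  assumes "n \<ge> 2" "n' \<le> n"
  shows "real n' * (amp ^^ levels n) (1 / 3) \<le> 1 / 60"
proof -
  define L j where "L = log 2 n" and "j = nat \<lceil>log 2 L\<rceil> + 3"
  have L: "L \<ge> 1" using assms(1) by (simp add: L_def)
  have "log 2 L + 3 \<le> j"
    using L by (simp add: j_def real_nat_ceiling_ge)
  then have "2 powr (log 2 L + 3) \<le> 2 powr j" by (intro powr_mono) auto
  then have "8 * L \<le> 2 ^ j"
    using L by (simp add: powr_add powr_realpow)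
  then have "2 powr (8 * L) \<le> 2 powr real (2 ^ j)" by (intro powr_mono) auto
  moreover have "2 powr (8 * L) = real n ^ 8"
  proof -
    have "2 powr (8 * L) = (2 powr L) powr real 8" by (simp add: powr_powr mult.commute)
    also have "\<dots> = real n powr real 8" using assms(1) by (simp add: L_def)
    also have "\<dots> = real n ^ 8" using assms(1) by (intro powr_realpow) simp
    finally show ?thesis .
  qed
  moreover have "(2::real) powr real (2 ^ j) = 2 ^ (2 ^ j)"
    by (rule powr_realpow) simp
  ultimately have pow: "real n ^ 8 \<le> 2 ^ (2 ^ j)" by simp
  \<comment> \<open>The target \<open>1 / 60\<close> amounts to
    \<open>15 * n \<le> 2 ^ (2 ^ j)\<close>, and \<open>n ^ 7 \<ge> 128\<close> leaves room.\<close>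
  have "real n * 15 \<le> real n * real n ^ 7"
  proof (rule mult_left_mono)
    have "(2::real) ^ 7 \<le> real n ^ 7" using assms(1) by (intro power_mono) auto
    then show "15 \<le> real n ^ 7" by simp
  qed simp
  also have "\<dots> = real n ^ 8" by (simp flip: power_Suc)
  finally have "real n * 15 \<le> 2 ^ (2 ^ j)" using pow by simp
  then have small: "real n * (1 / 4 * (1 / 2) ^ (2 ^ j)) \<le> 1 / 60"
    by (simp add: power_divide field_simps)
  have "levels n = j + 5" by (simp add: levels_def j_def L_def)
  then have "real n' * (amp ^^ levels n) (1 / 3) \<le> real n * (1 / 4 * (1 / 2) ^ (2 ^ j))"
    using assms(2) amp_iter_decay[of j] amp_iter_bounds(1)[of "j + 5"]
    by (intro mult_mono) auto
  with small show ?thesis by linarith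
qed

text \<open>\<open>4 powr log 2 (log 2 n)\<close> equals \<open>log 2 n ^ 2\<close>, which is the
  source of the polylogarithmic factor; rounding and the constant levels cost \<open>4 ^ 9\<close>,
  and the 9 is absorbed in \<open>4 ^ 18\<close>.\<close>

lemma power_levels_le:
  assumes "n \<ge> 2" "k \<le> 4"
  shows "9 * real k ^ levels n \<le> 4 ^ 18 * log 2 n ^ 2"
proof -
  define L where "L = log 2 n"
  have L: "L \<ge> 1" using assms(1) by (simp add: L_def)
  have "levels n \<le> log 2 L + 9"
  proof -
    have "real (nat \<lceil>log 2 L\<rceil>) \<le> log 2 L + 1"
      using L by (simp add: of_nat_nat of_int_ceiling_le_add_one)
    then show ?thesis by (simp add: levels_def L_def)
  qed
  then have "4 powr levels n \<le> 4 powr (log 2 L + 9)" by (intro powr_mono) auto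
  also have "\<dots> = 4 powr (log 2 L) * 4 ^ 9"
    by (simp add: powr_add)
  also have "4 powr (log 2 L) = L ^ 2"
  proof -
    have "(4::real) = 2 powr 2" by simp
    then have "4 powr (log 2 L) = 2 powr (2 * log 2 L)" by (metis powr_powr)
    also have "\<dots> = (2 powr log 2 L) powr 2" by (simp add: powr_powr mult.commute)
    finally show ?thesis using L by simp
  qed
  finally have "4 ^ levels n \<le> L ^ 2 * 4 ^ 9" by (simp add: powr_realpow)
  moreover have "real k ^ levels n \<le> 4 ^ levels n" using assms(2) by (intro power_mono) auto
  ultimately have "9 * real k ^ levels n \<le> 9 * (L ^ 2 * 4 ^ 9)" by simp
  also have "\<dots> \<le> 4 ^ 18 * L ^ 2" by simp
  finally show ?thesis by (simp add: L_def)
qed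

text \<open>With \<open>C = 2\<close>, fewer than \<open>levels n\<close> levels are available only for bounded depth.\<close>

lemma few_levels_bounded:
  assumes "n \<ge> 2" "real d \<ge> 2 * log 2 (log 2 n)" "d < levels n" "k \<le> 4"
  shows "real k ^ d \<le> 4 ^ 18"
proof -
  have "log 2 n \<ge> 1" using assms(1) by simp
  then have "0 \<le> log 2 (log 2 n)" by simp
  then have "real (nat \<lceil>log 2 (log 2 n)\<rceil>) < log 2 (log 2 n) + 1"
    by (simp add: of_nat_nat) linarith
  moreover have "real d < real (nat \<lceil>log 2 (log 2 n)\<rceil>) + 8"
    using assms(3) by (simp add: levels_def)
  \<comment> \<open>With \<open>x = log 2 (log 2 n)\<close> the bounds read
    \<open>2 * x \<le> d < x + 9\<close>, so \<open>x < 9\<close> and \<open>d < 18\<close>.\<close>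
  ultimately have "d < 18" using assms(2) by linarith
  then have "(4::real) ^ d \<le> 4 ^ 18" by (intro power_increasing) auto
  moreover have "real k ^ d \<le> 4 ^ d" using assms(4) by (intro power_mono) auto
  ultimately show ?thesis by linarith
qed

text \<open>For depth at least \<open>a = levels n\<close>, the lower bound is applied to
  \<open>f\<close>, the amplifier \<open>h^a\<close> and the inner function \<open>h^b\<close>;
  splitting the tower the other way bounds the degree of \<open>h^d\<close> by that of
  \<open>h^b\<close> times \<open>k ^ a\<close>. For smaller depth the arity of \<open>h^d\<close>
  is bounded.\<close>

lemma adeg_outer_bound:
  assumes kh: "(k, h) \<in> {(3, maj3), (4, and2_or2)}"
    and n: "n \<ge> 2" and d: "real d \<ge> 2 * log 2 (log 2 n)"
  shows "real (adeg n f) * real (adeg (k ^ d) (biter k h d))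
    \<le> 4 ^ 18 * log 2 n ^ 2 * real (adeg (n * k ^ d) (bcomp n (k ^ d) f (biter k h d)))"
    (is "?A * ?B \<le> 4 ^ 18 * ?L ^ 2 * real ?T")
proof -
  have k: "k \<le> 4" "k > 0" and h: "amplifies k h"
    using kh amplifies_maj3 amplifies_and2_or2 by auto
  have L: "1 \<le> ?L ^ 2" using n by (intro one_le_power) simp
  show ?thesis
  proof (cases "levels n \<le> d")
    case True
    define a b where "a = levels n" and "b = d - a"
    have ab: "d = a + b" using True by (simp add: a_def b_def)
    have "?T = adeg (n * (k ^ a * k ^ b))
        (bcomp n (k ^ a * k ^ b) f (bcomp (k ^ a) (k ^ b) (biter k h a) (biter k h b)))"
      unfolding ab power_add using biter_add
      by (intro adeg_cong bcomp_cong) (auto simp: power_add)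
    then have lower: "adeg n f * adeg (k ^ b) (biter k h b) \<le> 9 * ?T"
      using adeg_composition_lower[OF h levels_small[OF n order_refl]] by (simp add: a_def)
    have "adeg (k ^ d) (biter k h d) = adeg (k ^ b * k ^ a) (bcomp (k ^ b) (k ^ a) (biter k h b) (biter k h a))"
      unfolding ab add.commute[of a b] power_add using biter_add
      by (intro adeg_cong) (auto simp: power_add)
    then have "adeg (k ^ d) (biter k h d) \<le> adeg (k ^ b) (biter k h b) * k ^ a"
      by (simp add: adeg_bcomp_le)
    then have "adeg n f * adeg (k ^ d) (biter k h d) \<le> adeg n f * adeg (k ^ b) (biter k h b) * k ^ a"
      by (simp add: mult.assoc)
    also have "\<dots> \<le> 9 * ?T * k ^ a" using lower by (rule mult_le_mono1)
    finally have "real (adeg n f * adeg (k ^ d) (biter k h d)) \<le> real (9 * ?T * k ^ a)"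
      by (rule of_nat_mono)
    then have "?A * ?B \<le> 9 * real k ^ a * real ?T"
      by (simp add: mult_ac)
    also have "\<dots> \<le> 4 ^ 18 * ?L ^ 2 * real ?T"
      unfolding a_def by (intro mult_right_mono power_levels_le n k) simp
    finally show ?thesis .
  next
    case False
    have "?A \<le> real ?T" using adeg_outer_le[of h k n f d] replicate_amplifier[OF kh] k by simp
    moreover have "?B \<le> 4 ^ 18"
    proof -
      have "d < levels n" using False by simp
      from few_levels_bounded[OF n d this k(1)] have "real (k ^ d) \<le> 4 ^ 18" by simp
      moreover have "?B \<le> real (k ^ d)" by (intro of_nat_mono adeg_le_arity)
      ultimately show ?thesis by (rule order_trans[rotated])
    qed
    ultimately have "?A * ?B \<le> real ?T * 4 ^ 18" by (intro mult_mono) auto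
    also have "\<dots> \<le> real ?T * 4 ^ 18 * ?L ^ 2" using mult_left_mono[OF L, of "real ?T * 4 ^ 18"] by simp
    finally show ?thesis by (simp add: mult_ac)
  qed
qed

text \<open>Now \<open>h^b\<close> is the outer function, \<open>h^a\<close> the amplifier and
  \<open>g\<close> the inner function; a single splitting serves the lower and the upper bound. The
  outer arity \<open>k ^ b\<close> is at most \<open>n\<close>, so \<open>levels n\<close> levels
  are enough.\<close>

lemma adeg_inner_bound:
  assumes kh: "(k, h) \<in> {(3, maj3), (4, and2_or2)}"
    and n: "n \<ge> 2" and d: "real d \<ge> 2 * log 2 (log 2 n)" and nd: "n = k ^ d"
  shows "real (adeg n (biter k h d)) * real (adeg m g)
    \<le> 4 ^ 18 * log 2 n ^ 2 * real (adeg (n * m) (bcomp n m (biter k h d) g))"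
    (is "?A * ?B \<le> 4 ^ 18 * ?L ^ 2 * real ?T")
proof -
  have k: "k \<le> 4" "k > 0" and h: "amplifies k h"
    using kh amplifies_maj3 amplifies_and2_or2 by auto
  have L: "1 \<le> ?L ^ 2" using n by (intro one_le_power) simp
  show ?thesis
  proof (cases "levels n \<le> d")
    case True
    define a b where "a = levels n" and "b = d - a"
    have ba: "d = b + a" using True by (simp add: a_def b_def)
    have n_eq: "n = k ^ b * k ^ a" using nd ba by (simp add: power_add)
    have "?T = adeg (k ^ b * k ^ a * m)
        (bcomp (k ^ b * k ^ a) m (bcomp (k ^ b) (k ^ a) (biter k h b) (biter k h a)) g)"
      unfolding n_eq ba using biter_add
      by (intro adeg_cong bcomp_cong) (auto simp: power_add)
    also have "\<dots> = adeg (k ^ b * (k ^ a * m))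
        (bcomp (k ^ b) (k ^ a * m) (biter k h b) (bcomp (k ^ a) m (biter k h a) g))"
      unfolding mult.assoc[of "k ^ b" "k ^ a" m] by (intro adeg_cong bcomp_assoc)
    finally have T_eq: "?T = adeg (k ^ b * (k ^ a * m))
        (bcomp (k ^ b) (k ^ a * m) (biter k h b) (bcomp (k ^ a) m (biter k h a) g))" .
    have "k ^ b \<le> n" unfolding n_eq using k(2) by simp
    from levels_small[OF n this] have small: "real (k ^ b) * (amp ^^ a) (1 / 3) \<le> 1 / 60"
      by (simp add: a_def)
    have lower: "adeg (k ^ b) (biter k h b) * adeg m g \<le> 9 * ?T"
      unfolding T_eq by (rule adeg_composition_lower[OF h small])
    have "adeg n (biter k h d) = adeg (k ^ b * k ^ a) (bcomp (k ^ b) (k ^ a) (biter k h b) (biter k h a))"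
      unfolding n_eq ba using biter_add by (intro adeg_cong) (auto simp: power_add)
    then have "adeg n (biter k h d) \<le> adeg (k ^ b) (biter k h b) * k ^ a"
      by (simp add: adeg_bcomp_le)
    then have "adeg n (biter k h d) * adeg m g \<le> adeg (k ^ b) (biter k h b) * k ^ a * adeg m g"
      by (rule mult_le_mono1)
    also have "\<dots> = adeg (k ^ b) (biter k h b) * adeg m g * k ^ a" by simp
    also have "\<dots> \<le> 9 * ?T * k ^ a" using lower by (rule mult_le_mono1)
    finally have "real (adeg n (biter k h d) * adeg m g) \<le> real (9 * ?T * k ^ a)"
      by (rule of_nat_mono)
    then have "?A * ?B \<le> 9 * real k ^ a * real ?T"
      by (simp add: mult_ac)
    also have "\<dots> \<le> 4 ^ 18 * ?L ^ 2 * real ?T"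
      unfolding a_def by (intro mult_right_mono power_levels_le n k) simp
    finally show ?thesis .
  next
    case False
    have "?B \<le> real ?T" using adeg_inner_le[of h k m g d] replicate_amplifier[OF kh] nd by simp
    moreover have "?A \<le> 4 ^ 18"
    proof -
      have "d < levels n" using False by simp
      from few_levels_bounded[OF n d this k(1)] have "real (k ^ d) \<le> 4 ^ 18" by simp
      moreover have "?A \<le> real (k ^ d)" unfolding nd by (intro of_nat_mono adeg_le_arity)
      ultimately show ?thesis by (rule order_trans[rotated])
    qed
    ultimately have "?A * ?B \<le> 4 ^ 18 * real ?T" by (intro mult_mono) auto
    also have "\<dots> \<le> 4 ^ 18 * real ?T * ?L ^ 2" using mult_left_mono[OF L, of "4 ^ 18 * real ?T"] by simp
    finally show ?thesis by (simp add: mult_ac)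
  qed
qed

theorem theorem2:
  fixes k :: nat and h :: boolfun
  assumes "(k, h) \<in> {(3, maj3), (4, and2_or2)}"
  shows "\<exists>C::real. C > 0 \<and>
    (\<exists>c::real. c > 0 \<and> (\<exists>e::nat. \<forall>(n::nat) (f::boolfun) (d::nat).
        n \<ge> 2 \<longrightarrow> real d \<ge> C * log 2 (log 2 (real n)) \<longrightarrow>
        real (adeg (n * k ^ d) (bcomp n (k ^ d) f (biter k h d)))
          \<ge> c * (real (adeg n f) * real (adeg (k ^ d) (biter k h d)) / log 2 (real n) ^ e))) \<and>
    (\<exists>c::real. c > 0 \<and> (\<exists>e::nat. \<forall>(n::nat) (m::nat) (g::boolfun) (d::nat).
        n = k ^ d \<longrightarrow> n \<ge> 2 \<longrightarrow> real d \<ge> C * log 2 (log 2 (real n)) \<longrightarrow>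
        real (adeg (n * m) (bcomp n m (biter k h d) g))
          \<ge> c * (real (adeg n (biter k h d)) * real (adeg m g) / log 2 (real n) ^ e)))"
proof -
  \<comment> \<open>The constant \<open>4 ^ 18\<close> bounds both the cost of amplification in deep
    towers and the arity of shallow ones; \<open>C = 2\<close> is the value for which
    \<open>few_levels_bounded\<close> holds, and the exponent 2 is that of
    \<open>power_levels_le\<close>.\<close>
  let ?c = "1 / 4 ^ 18 :: real"
  have c: "?c > 0" by simp
  have rearrange: "?c * (X / log 2 n ^ 2) \<le> T"
    if "X \<le> 4 ^ 18 * log 2 n ^ 2 * T" "n \<ge> 2" for X T and n :: nat
  proof -
    have "1 \<le> log 2 n" using that(2) by simp
    then have "0 < log 2 n ^ 2" by simp
    with that(1) show ?thesis by (simp add: field_simps)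
  qed
  have outer: "\<forall>(n::nat) (f::boolfun) (d::nat).
        n \<ge> 2 \<longrightarrow> real d \<ge> 2 * log 2 (log 2 (real n)) \<longrightarrow>
        real (adeg (n * k ^ d) (bcomp n (k ^ d) f (biter k h d)))
          \<ge> ?c * (real (adeg n f) * real (adeg (k ^ d) (biter k h d)) / log 2 (real n) ^ 2)"
    using rearrange adeg_outer_bound[OF assms] by blast
  have inner: "\<forall>(n::nat) (m::nat) (g::boolfun) (d::nat).
        n = k ^ d \<longrightarrow> n \<ge> 2 \<longrightarrow> real d \<ge> 2 * log 2 (log 2 (real n)) \<longrightarrow>
        real (adeg (n * m) (bcomp n m (biter k h d) g))
          \<ge> ?c * (real (adeg n (biter k h d)) * real (adeg m g) / log 2 (real n) ^ 2)"
    using rearrange adeg_inner_bound[OF assms] by blast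
  show ?thesis
    by (rule exI[of _ 2], intro conjI;
        (simp; fail | (rule exI[of _ ?c], rule conjI[OF c], rule exI[of _ 2], rule outer inner)))
qed

end
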